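(* Fix $-\frac12<\theta<\frac12$. There is a Dirichlet series $g_\theta\in\mathscr{H}^2$ with \[\sigma_{\mathrm{c}}(g_\theta)=\theta,\qquad \sigma_{\mathrm{a}}(g_\theta)=\frac12,\qquad\text{and}\qquad \mu_{g_\theta}(\sigma)=\frac{1-2\sigma}{1-2\theta}\ \text{ for every } \theta<\sigma\leq\frac12.\]
   Context: Write $s=\sigma+it$. $\mathscr{H}^2$ is the Hilbert space of Dirichlet series $f(s)=\sum_{n\geq1}a_n n^{-s}$ with complex coefficients and $\|f\|_{\mathscr{H}^2}^2=\sum_{n\geq1}|a_n|^2<\infty$; such a series converges absolutely and is analytic in $\{\operatorname{Re}s>\frac12\}$. $\sigma_{\mathrm{c}}(f)$ and $\sigma_{\mathrm{a}}(f)$ denote the abscissa of convergence and the abscissa of absolute convergence of the Dirichlet series $f$. In the half-plane $\operatorname{Re}s>\sigma_{\mathrm{c}}(f)$, $f(s)$ denotes the sum of the convergent series, and the Lindelöf order function is \[\mu_f(\sigma)=\limsup_{|t|\to\infty}\frac{\log|f(\sigma+it)|}{\log|t|},\qquad \sigma>\sigma_{\mathrm{c}}(f).\] *)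

theory Defs
  imports "HOL-Analysis.Analysis"
begin

text \<open>
  A Dirichlet series is represented by its coefficient sequence \<open>a\<close>, where \<open>a n\<close> is the
  coefficient of \<open>n\<^sup>-\<^sup>s\<close> for \<open>n \<ge> 1\<close>. The value \<open>a 0\<close> is never used: all sums below are
  shifted by \<open>Suc\<close>.
\<close>

definition dirichlet_term :: "(nat \<Rightarrow> complex) \<Rightarrow> complex \<Rightarrow> nat \<Rightarrow> complex" where
  "dirichlet_term a s n = a n * of_nat n powr (- s)"

definition dirichlet_sum :: "(nat \<Rightarrow> complex) \<Rightarrow> complex \<Rightarrow> complex" where
  "dirichlet_sum a s = (\<Sum>n. dirichlet_term a s (Suc n))"

definition hardy_H2 :: "(nat \<Rightarrow> complex) set" where
  "hardy_H2 = {a. summable (\<lambda>n. (cmod (a (Suc n)))\<^sup>2)}"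

text \<open>The abscissas take the values \<open>\<infinity>\<close> and \<open>-\<infinity>\<close> when the series converges nowhere
  or everywhere, hence the type \<^typ>\<open>ereal\<close>.\<close>

definition conv_abscissa :: "(nat \<Rightarrow> complex) \<Rightarrow> ereal" where
  "conv_abscissa a =
     (INF s\<in>{s. summable (\<lambda>n. dirichlet_term a s (Suc n))}. ereal (Re s))"

definition abs_conv_abscissa :: "(nat \<Rightarrow> complex) \<Rightarrow> ereal" where
  "abs_conv_abscissa a =
     (INF s\<in>{s. summable (\<lambda>n. cmod (dirichlet_term a s (Suc n)))}. ereal (Re s))"

text \<open>The real function \<^term>\<open>ln\<close> satisfies \<open>ln 0 = 0\<close>; at zeros of the Dirichlet series we
  need the convention \<open>log 0 = -\<infinity>\<close> instead.\<close>

definition ext_log :: "real \<Rightarrow> ereal" where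
  "ext_log x = (if x = 0 then -\<infinity> else ereal (ln x))"

text \<open>On the reals, the filter \<^term>\<open>at_infinity\<close> expresses \<open>\<bar>t\<bar> \<rightarrow> \<infinity>\<close>, i.e. it
  covers both \<open>t \<rightarrow> \<infinity>\<close> and \<open>t \<rightarrow> -\<infinity>\<close>. The definition is meaningful only for
  \<open>\<sigma>\<close> to the right of the abscissa of convergence.\<close>

definition lindelof_order :: "(nat \<Rightarrow> complex) \<Rightarrow> real \<Rightarrow> ereal" where
  "lindelof_order a \<sigma> =
     Limsup (at_infinity :: real filter)
       (\<lambda>t. ext_log (cmod (dirichlet_sum a (Complex \<sigma> t))) / ereal (ln \<bar>t\<bar>))"

end

theory Submission
  imports Defs
begin

text \<open>
  Put \<open>\<beta> = 1/2 - \<theta>\<close>, so that \<open>0 < \<beta> < 1\<close>. The series is built from its partial sums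
  \<open>b\<^sub>n\<close> rather than from its coefficients \<open>a\<^sub>n = b\<^sub>n - b\<^bsub>n-1\<^esub>\<close>. For a sparse sequence of
  scales \<open>N\<close>, to each of which belongs a frequency \<open>T\<close> comparable to \<open>N\<^sup>\<beta>\<close>, let

  \<open>b\<^sub>n = c N\<^bsup>1/2\<^esup>/T ((n/N)\<^bsup>iT\<^esup> - 1)\<close> for \<open>N \<le> n \<le> 2N\<close>, \<open>b\<^sub>1 = 1\<close>, and \<open>b\<^sub>n = 0\<close> otherwise,

  where the factors \<open>c\<close> are summable and \<open>T\<close> is a multiple of \<open>2\<pi>/ln 2\<close>, so that \<open>b\<close> vanishes at
  both ends of every block. Then \<open>b\<^sub>n = O(n\<^sup>\<theta>)\<close>. Because a step of \<open>n\<^bsup>iT\<^esup>\<close> has size about \<open>T/n\<close>,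
  which tends to \<open>0\<close> on the blocks as \<open>N\<close> grows, the coefficients satisfy
  \<open>\<bar>a\<^sub>n\<bar> \<le> c N\<^bsup>-1/2\<^esup>\<close>, and at \<open>s = \<sigma> + iT\<close> the terms of the block are nearly
  aligned: their sum has modulus at least a constant times
  \<open>c N\<^bsup>1/2-\<sigma>\<^esup>\<close> (\<open>block_lower_bound\<close>). No estimate for exponential sums is involved, since the
  cancellation in the partial sums is a telescoping identity.

  Upper bound for the order. If the partial sums are \<open>O(n\<^sup>\<kappa>)\<close>, Abel summation bounds the
  tail after \<open>X\<close> terms by \<open>(1 + \<bar>s\<bar>) X\<^bsup>\<kappa>-\<sigma>\<^esup>\<close> (\<open>dirichlet_tail\<close>), while
  \<open>a\<^sub>n = O(n\<^bsup>-1/2\<^esup>)\<close> bounds the first \<open>X\<close> terms by \<open>X\<^bsup>1/2-\<sigma>\<^esup>\<close> (\<open>dirichlet_head\<close>). The choice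
  \<open>X = \<bar>t\<bar>\<^bsup>1/(1/2-\<kappa>)\<^esup>\<close> makes both equal to \<open>\<bar>t\<bar>\<close> to the power \<open>(1/2-\<sigma>)/(1/2-\<kappa>)\<close>
  (\<open>dirichlet_growth\<close>); for \<open>\<kappa> = \<theta>\<close> this is the asserted order.

  Lower bound for the order. Because the logarithms of the scales grow faster than geometrically, at
  \<open>s = \<sigma> + iT\<close> the earlier blocks and the later blocks are negligible against the block that
  resonates with \<open>T\<close> (\<open>resonance\<close>), and \<open>N\<^bsup>1/2-\<sigma>\<^esup>\<close> is \<open>T\<close> to the power
  \<open>(1/2-\<sigma>)/\<beta>\<close> up to a constant; the factor \<open>c\<close> decays more slowly than any negative power of \<open>N\<close>. On the line
  \<open>\<sigma> = 1/2\<close> the series converges absolutely and the two terms \<open>1 - 2\<^bsup>-s\<^esup>\<close> that come from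
  \<open>b\<^sub>1\<close> dominate all the others, so that its modulus stays between two positive constants.

  Both abscissas are then forced by the order. Convergence at a point with real part \<open>\<kappa> < \<theta>\<close>
  would allow that exponent \<open>\<kappa>\<close> in \<open>dirichlet_growth\<close>, which contradicts the lower bound for
  the order; absolute convergence to the left of \<open>1/2\<close> would make the series bounded on vertical
  lines where its order is positive.
\<close>

section \<open>Terms of a Dirichlet series\<close>

lemma norm_dirichlet_term:
  assumes "n \<ge> 1"
  shows "cmod (dirichlet_term a s n) = cmod (a n) * real n powr (- Re s)"
  using assms by (simp add: dirichlet_term_def norm_mult norm_powr_real_powr)

lemma dirichlet_term_add:
  "n \<ge> 1 \<Longrightarrow> dirichlet_term a (s + w) n = dirichlet_term a s n * of_nat n powr (- w)"
  by (simp add: dirichlet_term_def powr_diff divide_simps powr_minus)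

lemma powr_minus_Complex:
  assumes "n \<ge> 1"
  shows "of_nat n powr (- Complex \<sigma> t) = of_real (real n powr (- \<sigma>)) * cis (- t * ln (real n))"
proof -
  have "of_nat n powr (- Complex \<sigma> t) = exp (- Complex \<sigma> t * of_real (ln (real n)))"
    using assms by (simp add: powr_def Ln_of_nat)
  also have "- Complex \<sigma> t * of_real (ln (real n)) = Complex (- \<sigma> * ln (real n)) (- t * ln (real n))"
    by (simp add: complex_eq_iff)
  also have "exp \<dots> = of_real (exp (- \<sigma> * ln (real n))) * cis (- t * ln (real n))"
    by (simp add: exp_eq_polar)
  finally show ?thesis using assms by (simp add: powr_def)
qed

section \<open>Abel summation for Dirichlet series\<close>

text \<open>
  The mean value inequality on the segment from \<open>n\<close> to \<open>n + 1\<close>. The hypothesis on \<open>Re w\<close> makes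
  the modulus of the derivative decreasing, so that its value at \<open>n\<close> is the largest.
\<close>

lemma norm_powr_nat_diff_le:
  fixes w :: complex
  assumes "n \<ge> 1" and "Re w \<ge> - 1"
  shows "cmod (of_nat n powr (- w) - of_nat (Suc n) powr (- w))
           \<le> cmod w * real n powr (- Re w - 1)"
proof -
  let ?S = "closed_segment (of_nat n) (of_nat (Suc n)) :: complex set"
  have seg: "\<exists>x. z = of_real x \<and> real n \<le> x" if z: "z \<in> ?S" for z
  proof -
    obtain u where u: "0 \<le> u" "u \<le> 1" "z = (1 - u) *\<^sub>R of_nat n + u *\<^sub>R of_nat (Suc n)"
      using z unfolding closed_segment_def by blast
    then have "z = of_real (real n + u)"
      by (simp add: scaleR_conv_of_real algebra_simps)
    with u show ?thesis by (intro exI[of _ "real n + u"]) auto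
  qed
  have "cmod (of_nat n powr (- w) - of_nat (Suc n) powr (- w))
          \<le> (cmod w * real n powr (- Re w - 1)) * cmod (of_nat n - of_nat (Suc n) :: complex)"
  proof (rule field_differentiable_bound[where S = ?S and f' = "\<lambda>z. - w * z powr (- w - 1)"])
    show "convex ?S" by simp
    show "((\<lambda>z. z powr (- w)) has_field_derivative - w * z powr (- w - 1)) (at z within ?S)"
      if z: "z \<in> ?S" for z
    proof -
      obtain x where "z = of_real x" "real n \<le> x" using seg[OF z] by blast
      then have "z \<notin> \<real>\<^sub>\<le>\<^sub>0" using assms(1) by auto
      then show ?thesis
        by (rule has_field_derivative_at_within[OF has_field_derivative_powr])
    qed
    show "cmod (- w * z powr (- w - 1)) \<le> cmod w * real n powr (- Re w - 1)" if z: "z \<in> ?S" for z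
    proof -
      obtain x where x: "z = of_real x" "real n \<le> x" using seg[OF z] by blast
      have "cmod (z powr (- w - 1)) = x powr (- Re w - 1)"
        using x assms(1) by (simp add: norm_powr_real_powr)
      also have "\<dots> \<le> real n powr (- Re w - 1)"
        using x assms by (intro powr_mono2') auto
      finally show ?thesis by (simp add: norm_mult mult_left_mono)
    qed
  qed auto
  then show ?thesis by (simp add: norm_minus_commute)
qed

lemma summation_by_parts:
  fixes a w :: "nat \<Rightarrow> 'a::comm_ring"
  shows "(\<Sum>m<n. a (Suc m) * w (Suc m)) =
           (\<Sum>m<n. (\<Sum>j<Suc m. a (Suc j)) * (w (Suc m) - w (Suc (Suc m))))
             + (\<Sum>j<n. a (Suc j)) * w (Suc n)"
  by (induction n) (simp_all add: algebra_simps)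

text \<open>
  The terms \<open>n\<^bsup>-1-\<delta>\<^esup>\<close> are compared with a telescoping series instead of an integral.
\<close>

lemma powr_diff_ge:
  fixes \<delta> :: real
  assumes "\<delta> > 0"
  shows "\<delta> * real (n + 2) powr (- \<delta> - 1) \<le> real (n + 1) powr (- \<delta>) - real (n + 2) powr (- \<delta>)"
proof -
  have "\<exists>z>real (n + 1). z < real (n + 2) \<and>
      real (n + 2) powr (- \<delta>) - real (n + 1) powr (- \<delta>) =
        (real (n + 2) - real (n + 1)) * (- \<delta> * z powr (- \<delta> - 1))"
    by (intro MVT2) (auto intro!: derivative_eq_intros simp: powr_diff)
  then obtain z where z: "z > real (n + 1)" "z < real (n + 2)"
    "real (n + 1) powr (- \<delta>) - real (n + 2) powr (- \<delta>) = \<delta> * z powr (- \<delta> - 1)"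
    by (auto simp: algebra_simps)
  have "real (n + 2) powr (- \<delta> - 1) \<le> z powr (- \<delta> - 1)"
    using z assms by (intro powr_mono2') auto
  with z assms show ?thesis by simp
qed

lemma tendsto_nat_powr_neg:
  fixes \<delta> :: real
  assumes "\<delta> > 0"
  shows "(\<lambda>n. real (n + m) powr (- \<delta>)) \<longlonglongrightarrow> 0"
  using LIMSEQ_ignore_initial_segment[OF tendsto_neg_powr[of "- \<delta>" real sequentially], of m]
    assms filterlim_real_sequentially by simp

lemma sums_powr_diff:
  fixes \<delta> :: real
  assumes "\<delta> > 0"
  shows "(\<lambda>n. real (n + m + 1) powr (- \<delta>) - real (n + m + 2) powr (- \<delta>)) sums
           real (m + 1) powr (- \<delta>)"
proof -
  have "(\<lambda>n. real (n + (m + 1)) powr (- \<delta>)) \<longlonglongrightarrow> 0"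
    by (rule tendsto_nat_powr_neg[OF assms])
  from telescope_sums'[OF this] show ?thesis by (simp add: algebra_simps)
qed

text \<open>
  The partial sums may be measured at any point \<open>s\<^sub>0\<close>, and with any power of \<open>n\<close>. Both forms are
  needed: \<open>s\<^sub>0 = 0\<close> with the known size of the partial sums of the coefficients, and a
  hypothetical point of convergence \<open>s\<^sub>0\<close> with bounded partial sums, \<open>\<kappa> = 0\<close>. The tail bound
  depends on \<open>s\<close> only through its real part and one factor that is affine in \<open>\<bar>s - s\<^sub>0\<bar>\<close>.
\<close>

lemma dirichlet_tail:
  fixes a :: "nat \<Rightarrow> complex" and s\<^sub>0 :: complex and C \<kappa> \<rho> :: real
  assumes A: "\<And>n. cmod (\<Sum>m<n. dirichlet_term a s\<^sub>0 (Suc m)) \<le> C * real (n + 1) powr \<kappa>"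
    and \<rho>: "\<rho> > \<kappa>" "\<rho> \<ge> - 1" and s: "Re s = Re s\<^sub>0 + \<rho>"
  shows "summable (\<lambda>n. dirichlet_term a s (Suc n))"
    and "cmod (dirichlet_sum a s - (\<Sum>m<n. dirichlet_term a s (Suc m)))
           \<le> C * (1 + cmod (s - s\<^sub>0) * 2 powr (\<rho> + 1) / (\<rho> - \<kappa>)) * real (n + 1) powr (\<kappa> - \<rho>)"
proof -
  define w where "w = s - s\<^sub>0"
  define \<delta> where "\<delta> = \<rho> - \<kappa>"
  define S where "S = (\<lambda>n. \<Sum>m<n. dirichlet_term a s\<^sub>0 (Suc m))"
  define E where "E = (\<lambda>n. S (Suc n) * (of_nat (Suc n) powr (- w) - of_nat (Suc (Suc n)) powr (- w)))"
  define B where "B = (\<lambda>n. S n * of_nat (Suc n) powr (- w))"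
  define K where "K = C * cmod w * 2 powr (\<rho> + 1) / \<delta>"
  have [simp]: "Re w = \<rho>" using s by (simp add: w_def)
  have \<delta>: "\<delta> > 0" using \<rho> by (simp add: \<delta>_def)
  have S: "cmod (S n) \<le> C * real (n + 1) powr \<kappa>" for n using A by (simp add: S_def)
  have C: "C \<ge> 0" using order_trans[OF norm_ge_zero S[of 0]] by simp
  have parts: "(\<Sum>m<n. dirichlet_term a s (Suc m)) = (\<Sum>m<n. E m) + B n" for n
  proof -
    have "(\<Sum>m<n. dirichlet_term a s (Suc m)) =
            (\<Sum>m<n. dirichlet_term a s\<^sub>0 (Suc m) * of_nat (Suc m) powr (- w))"
      using dirichlet_term_add[of _ a s\<^sub>0 w] by (simp add: w_def)
    also have "\<dots> = (\<Sum>m<n. E m) + B n"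
      unfolding E_def B_def S_def by (rule summation_by_parts)
    finally show ?thesis .
  qed
  have B: "cmod (B n) \<le> C * real (n + 1) powr (- \<delta>)" for n
  proof -
    have "cmod (B n) = cmod (S n) * real (n + 1) powr (- \<rho>)"
      by (simp add: B_def norm_mult norm_powr_real_powr del: of_nat_Suc)
    also have "\<dots> \<le> (C * real (n + 1) powr \<kappa>) * real (n + 1) powr (- \<rho>)"
      using S by (intro mult_right_mono) auto
    also have "\<dots> = C * real (n + 1) powr (- \<delta>)"
      by (simp add: \<delta>_def powr_add[symmetric] mult.assoc)
    finally show ?thesis .
  qed
  have E: "cmod (E n) \<le> K * (real (n + 1) powr (- \<delta>) - real (n + 2) powr (- \<delta>))" for n
  proof -
    have "cmod (E n) = cmod (S (Suc n)) *
            cmod (of_nat (Suc n) powr (- w) - of_nat (Suc (Suc n)) powr (- w))"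
      by (simp add: E_def norm_mult)
    also have "\<dots> \<le> (C * real (n + 2) powr \<kappa>) * (cmod w * real (n + 1) powr (- \<rho> - 1))"
      using S[of "Suc n"] norm_powr_nat_diff_le[of "Suc n" w] \<rho> C by (intro mult_mono) (auto simp: add_ac)
    also have "real (n + 1) powr (- \<rho> - 1) \<le> (real (n + 2) / 2) powr (- \<rho> - 1)"
      using \<rho> by (intro powr_mono2') auto
    also have "\<dots> = 2 powr (\<rho> + 1) * real (n + 2) powr (- \<rho> - 1)"
      using powr_minus_divide[of 2 "\<rho> + 1"] by (simp add: powr_divide)
    also have "(C * real (n + 2) powr \<kappa>) * (cmod w * \<dots>) =
        (C * cmod w * 2 powr (\<rho> + 1)) * (real (n + 2) powr \<kappa> * real (n + 2) powr (- \<rho> - 1))"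
      by (simp only: mult_ac)
    also have "C * cmod w * 2 powr (\<rho> + 1) = K * \<delta>" using \<delta> by (simp add: K_def)
    also have "real (n + 2) powr \<kappa> * real (n + 2) powr (- \<rho> - 1) = real (n + 2) powr (- \<delta> - 1)"
      by (simp only: powr_add[symmetric] \<delta>_def) (simp add: algebra_simps)
    also have "(K * \<delta>) * \<dots> = K * (\<delta> * \<dots>)" by simp
    also have "\<dots> \<le> K * (real (n + 1) powr (- \<delta>) - real (n + 2) powr (- \<delta>))"
      using powr_diff_ge[OF \<delta>, of n] \<delta> C by (intro mult_left_mono) (auto simp: K_def)
    finally show ?thesis using C by (simp add: mult_left_mono)
  qed
  have sE: "summable E"
    by (rule summable_comparison_test'[OF summable_mult[OF sums_summable[OF sums_powr_diff[OF \<delta>, of 0]], of K], of 0])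
       (use E in \<open>simp add: add_ac\<close>)
  have B0: "B \<longlonglongrightarrow> 0"
  proof (rule Lim_null_comparison)
    show "\<forall>\<^sub>F n in sequentially. cmod (B n) \<le> C * real (n + 1) powr (- \<delta>)" using B by simp
    from tendsto_mult_left[OF tendsto_nat_powr_neg[OF \<delta>, of 1], of C] show "(\<lambda>n. C * real (n + 1) powr (- \<delta>)) \<longlonglongrightarrow> 0" by simp
  qed
  have sums: "(\<lambda>n. dirichlet_term a s (Suc n)) sums suminf E"
    unfolding sums_def parts using tendsto_add[OF summable_LIMSEQ[OF sE] B0] by simp
  then show "summable (\<lambda>n. dirichlet_term a s (Suc n))" by (rule sums_summable)
  have factor: "C * c * p / d * y + C * y = C * (1 + c * p / d) * y" for c p d y :: real
    by (simp add: algebra_simps)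
  have tailE: "cmod (\<Sum>m. E (m + n)) \<le> K * real (n + 1) powr (- \<delta>)"
  proof -
    note majorant = sums_mult[OF sums_powr_diff[OF \<delta>, of n], of K]
    have "cmod (E (m + n)) \<le> K * (real (m + n + 1) powr (- \<delta>) - real (m + n + 2) powr (- \<delta>))" for m
      by (rule E)
    from norm_suminf_le[OF this sums_summable[OF majorant]] show ?thesis
      by (simp only: sums_unique[OF majorant, symmetric])
  qed
  have "dirichlet_sum a s - (\<Sum>m<n. dirichlet_term a s (Suc m)) = (\<Sum>m. E (m + n)) - B n"
    using sums suminf_minus_initial_segment[OF sE, of n]
    by (simp add: dirichlet_sum_def sums_iff parts)
  also have "cmod \<dots> \<le> cmod (\<Sum>m. E (m + n)) + cmod (B n)" by (rule norm_triangle_ineq4)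
  also have "\<dots> \<le> K * real (n + 1) powr (- \<delta>) + C * real (n + 1) powr (- \<delta>)"
    by (rule add_mono[OF tailE B])
  finally show "cmod (dirichlet_sum a s - (\<Sum>m<n. dirichlet_term a s (Suc m)))
           \<le> C * (1 + cmod (s - s\<^sub>0) * 2 powr (\<rho> + 1) / (\<rho> - \<kappa>)) * real (n + 1) powr (\<kappa> - \<rho>)"
    unfolding K_def w_def \<delta>_def minus_diff_eq factor .
qed

section \<open>Growth on vertical lines\<close>

lemma sum_powr_le:
  fixes L :: real
  assumes "0 < L" "L \<le> 1"
  shows "(\<Sum>m<n. real (Suc m) powr (L - 1)) \<le> real n powr L / L"
proof (induction n)
  case (Suc n)
  have "real (Suc n) powr (L - 1) \<le> (real (Suc n) powr L - real n powr L) / L"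
  proof (cases "n = 0")
    case False
    have "\<exists>z>real n. z < real (Suc n) \<and> real (Suc n) powr L - real n powr L =
        (real (Suc n) - real n) * (L * z powr (L - 1))"
      by (rule MVT2) (use False in \<open>auto intro!: derivative_eq_intros simp: powr_diff\<close>)
    then obtain z where z: "z > real n" "z < real (Suc n)"
      "real (Suc n) powr L - real n powr L = L * z powr (L - 1)" by auto
    have "real (Suc n) powr (L - 1) \<le> z powr (L - 1)"
      using z assms False by (intro powr_mono2') auto
    with z assms show ?thesis by simp
  qed (use assms in auto)
  with Suc show ?case by (simp add: diff_divide_distrib)
qed auto

lemma dirichlet_head:
  fixes a :: "nat \<Rightarrow> complex" and C :: real
  assumes a: "\<And>n. n \<ge> 1 \<Longrightarrow> cmod (a n) \<le> C * real n powr (- 1 / 2)"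
    and s: "- 1 / 2 < Re s" "Re s < 1 / 2"
  shows "cmod (\<Sum>m<n. dirichlet_term a s (Suc m)) \<le> C / (1 / 2 - Re s) * real n powr (1 / 2 - Re s)"
proof -
  have C: "C \<ge> 0" using order_trans[OF norm_ge_zero a[of 1]] by simp
  have "cmod (\<Sum>m<n. dirichlet_term a s (Suc m)) \<le> (\<Sum>m<n. C * real (Suc m) powr ((1 / 2 - Re s) - 1))"
  proof (rule sum_norm_le)
    fix m
    have "cmod (dirichlet_term a s (Suc m)) \<le> (C * real (Suc m) powr (- 1 / 2)) * real (Suc m) powr (- Re s)"
      using a[of "Suc m"] by (simp add: norm_dirichlet_term mult_right_mono)
    also have "\<dots> = C * real (Suc m) powr ((1 / 2 - Re s) - 1)"
      by (simp add: powr_add [symmetric] mult.assoc)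
    finally show "cmod (dirichlet_term a s (Suc m)) \<le> C * real (Suc m) powr ((1 / 2 - Re s) - 1)" .
  qed
  also have "\<dots> \<le> C * (real n powr (1 / 2 - Re s) / (1 / 2 - Re s))"
    unfolding sum_distrib_left[symmetric] using s C
    by (intro mult_left_mono sum_powr_le) auto
  finally show ?thesis by simp
qed

text \<open>
  With \<open>\<kappa>' = Re s\<^sub>0 + \<kappa>\<close>, the head of length \<open>X\<close> is at most a constant times
  \<open>X\<^bsup>1/2-\<sigma>\<^esup>\<close> and the tail at most a constant times \<open>\<bar>t\<bar> X\<^bsup>\<kappa>'-\<sigma>\<^esup>\<close>. They balance at
  \<open>X = \<bar>t\<bar>\<^bsup>1/(1/2-\<kappa>')\<^esup>\<close>.
\<close>

lemma dirichlet_growth: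
  fixes a :: "nat \<Rightarrow> complex" and C D \<kappa> \<sigma> :: real
  assumes a: "\<And>n. n \<ge> 1 \<Longrightarrow> cmod (a n) \<le> C * real n powr (- 1 / 2)"
    and A: "\<And>n. cmod (\<Sum>m<n. dirichlet_term a s\<^sub>0 (Suc m)) \<le> D * real (n + 1) powr \<kappa>"
    and \<sigma>: "Re s\<^sub>0 + \<kappa> < \<sigma>" "Re s\<^sub>0 - 1 \<le> \<sigma>" "- 1 / 2 < \<sigma>" "\<sigma> < 1 / 2"
  obtains M where "\<And>t. \<bar>t\<bar> \<ge> 1 \<Longrightarrow> cmod (dirichlet_sum a (Complex \<sigma> t))
              \<le> M * \<bar>t\<bar> powr ((1 / 2 - \<sigma>) / (1 / 2 - (Re s\<^sub>0 + \<kappa>)))"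
proof -
  define \<beta> where "\<beta> = 1 / 2 - (Re s\<^sub>0 + \<kappa>)"
  define L where "L = 1 / 2 - \<sigma>"
  define \<rho> where "\<rho> = \<sigma> - Re s\<^sub>0"
  \<comment> \<open>For \<open>\<bar>t\<bar> \<ge> 1\<close> the distance from \<open>Complex \<sigma> t\<close> to \<open>s\<^sub>0\<close> is at most \<open>Q * \<bar>t\<bar>\<close>.\<close>
  define Q where "Q = 1 + cmod (Complex \<sigma> 0 - s\<^sub>0) + 1"
  define R where "R = 2 powr (\<rho> + 1) / (\<rho> - \<kappa>)"
  have \<beta>: "\<beta> > 0" "\<beta> \<ge> L" and L: "L > 0" and \<rho>: "\<rho> > \<kappa>" "\<rho> \<ge> - 1"
    using \<sigma> by (auto simp: \<beta>_def L_def \<rho>_def)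
  have C: "C \<ge> 0" using order_trans[OF norm_ge_zero a[of 1]] by simp
  have D: "D \<ge> 0" using order_trans[OF norm_ge_zero A[of 0]] by simp
  have R: "R \<ge> 0" using \<rho> by (simp add: R_def)
  have Q: "Q \<ge> 1" by (simp add: Q_def)
  show thesis
  proof (rule that[of "C / L + D * (1 + Q * R)"])
    fix t :: real assume t: "\<bar>t\<bar> \<ge> 1"
    define X where "X = \<bar>t\<bar> powr (1 / \<beta>)"
    define n where "n = nat \<lfloor>X\<rfloor>"
    have X: "X \<ge> 1" using t \<beta> by (simp add: X_def ge_one_powr_ge_zero)
    have n: "real n \<le> X" "X \<le> real (n + 1)" using X unfolding n_def by linarith+
    have XL: "X powr L = \<bar>t\<bar> powr (L / \<beta>)" by (simp add: X_def powr_powr)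
    define s where "s = Complex \<sigma> t"
    have "cmod (\<Sum>m<n. dirichlet_term a s (Suc m)) \<le> C / L * real n powr L"
      using dirichlet_head[of a C s n] a \<sigma> by (simp add: s_def L_def)
    also have "\<dots> \<le> C / L * X powr L"
      using n C L by (intro mult_left_mono powr_mono2) auto
    finally have head: "cmod (\<Sum>m<n. dirichlet_term a s (Suc m)) \<le> C / L * \<bar>t\<bar> powr (L / \<beta>)"
      by (simp add: XL)
    have exponent: "1 + (\<kappa> - \<rho>) / \<beta> = L / \<beta>"
    proof -
      have "L = \<beta> + (\<kappa> - \<rho>)" by (simp add: \<beta>_def L_def \<rho>_def)
      then show ?thesis using \<beta> by (simp add: add_divide_distrib diff_divide_distrib)
    qed
    have "cmod (s - s\<^sub>0) \<le> cmod (Complex \<sigma> 0 - s\<^sub>0) + cmod (Complex 0 t)"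
      by (rule order_trans[OF _ norm_triangle_ineq]) (simp add: s_def complex_eq_iff Complex_eq algebra_simps)
    also have "cmod (Complex 0 t) = \<bar>t\<bar>" by (simp add: cmod_def)
    also have "cmod (Complex \<sigma> 0 - s\<^sub>0) + \<bar>t\<bar> \<le> cmod (Complex \<sigma> 0 - s\<^sub>0) * \<bar>t\<bar> + 2 * \<bar>t\<bar>"
      using t mult_left_mono[OF t, of "cmod (Complex \<sigma> 0 - s\<^sub>0)"] by simp
    finally have w: "cmod (s - s\<^sub>0) \<le> Q * \<bar>t\<bar>" by (simp add: Q_def algebra_simps)
    have "cmod (dirichlet_sum a s - (\<Sum>m<n. dirichlet_term a s (Suc m)))
        \<le> D * (1 + cmod (s - s\<^sub>0) * 2 powr (\<rho> + 1) / (\<rho> - \<kappa>)) * real (n + 1) powr (\<kappa> - \<rho>)"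
      by (rule dirichlet_tail) (use A \<rho> in \<open>auto simp: s_def \<rho>_def\<close>)
    also have "\<dots> = D * (1 + cmod (s - s\<^sub>0) * R) * real (n + 1) powr (\<kappa> - \<rho>)"
      by (simp add: R_def)
    also have "\<dots> \<le> D * (\<bar>t\<bar> + (Q * \<bar>t\<bar>) * R) * X powr (\<kappa> - \<rho>)"
      using w t D R Q n X \<rho> by (intro mult_mono add_mono powr_mono2' mult_nonneg_nonneg add_nonneg_nonneg mult_right_mono) auto
    also have "\<dots> = D * (1 + Q * R) * (\<bar>t\<bar> powr 1 * X powr (\<kappa> - \<rho>))"
    proof -
      have "D * (u + (Q * u) * R) * y = D * (1 + Q * R) * (u * y)" for u y :: real
        by (simp add: algebra_simps)
      then show ?thesis by simp
    qed
    also have "X powr (\<kappa> - \<rho>) = \<bar>t\<bar> powr ((\<kappa> - \<rho>) / \<beta>)" by (simp add: X_def powr_powr)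
    also have "\<bar>t\<bar> powr 1 * \<bar>t\<bar> powr ((\<kappa> - \<rho>) / \<beta>) = \<bar>t\<bar> powr (L / \<beta>)"
      unfolding powr_add[symmetric] using \<beta> exponent by simp
    finally have tail: "cmod (dirichlet_sum a s - (\<Sum>m<n. dirichlet_term a s (Suc m)))
        \<le> D * (1 + Q * R) * \<bar>t\<bar> powr (L / \<beta>)" .
    have "cmod (dirichlet_sum a s) \<le> cmod (\<Sum>m<n. dirichlet_term a s (Suc m)) +
            cmod (dirichlet_sum a s - (\<Sum>m<n. dirichlet_term a s (Suc m)))"
      by (rule order_trans[OF _ norm_triangle_ineq]) simp
    also have "\<dots> \<le> (C / L + D * (1 + Q * R)) * \<bar>t\<bar> powr (L / \<beta>)"
      using add_mono[OF head tail] by (simp only: distrib_right)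
    finally show "cmod (dirichlet_sum a (Complex \<sigma> t)) \<le> (C / L + D * (1 + Q * R)) *
        \<bar>t\<bar> powr ((1 / 2 - \<sigma>) / (1 / 2 - (Re s\<^sub>0 + \<kappa>)))"
      by (simp add: s_def L_def \<beta>_def)
  qed
qed

section \<open>Bounds for the Lindelof order\<close>

lemma lindelof_order_le:
  fixes M \<alpha> :: real
  assumes "\<And>t. \<bar>t\<bar> \<ge> 1 \<Longrightarrow> cmod (dirichlet_sum a (Complex \<sigma> t)) \<le> M * \<bar>t\<bar> powr \<alpha>"
  shows "lindelof_order a \<sigma> \<le> ereal \<alpha>"
proof -
  \<comment> \<open>For \<open>M = 0\<close> the logarithm of \<open>M * \<bar>t\<bar> powr \<alpha>\<close> would not split into a sum.\<close>
  define M' where "M' = max M 1"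
  have lim: "((\<lambda>t. ereal (ln M' / ln \<bar>t\<bar> + \<alpha>)) \<longlongrightarrow> ereal \<alpha>) (at_infinity :: real filter)"
  proof -
    have "filterlim (\<lambda>t. ln \<bar>t\<bar>) at_top (at_infinity :: real filter)"
      using filterlim_compose[OF ln_at_top filterlim_norm_at_top[where 'a = real]]
      by (simp only: real_norm_def)
    from tendsto_divide_0[OF tendsto_const filterlim_at_top_imp_at_infinity[OF this], of "ln M'"]
    have "((\<lambda>t. ln M' / ln \<bar>t\<bar> + \<alpha>) \<longlongrightarrow> 0 + \<alpha>) (at_infinity :: real filter)"
      by (intro tendsto_add) auto
    then show ?thesis by simp
  qed
  have "lindelof_order a \<sigma> \<le> Limsup at_infinity (\<lambda>t::real. ereal (ln M' / ln \<bar>t\<bar> + \<alpha>))"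
    unfolding lindelof_order_def
  proof (rule Limsup_mono)
    have "\<forall>\<^sub>F t::real in at_infinity. \<bar>t\<bar> \<ge> 2"
      unfolding eventually_at_infinity by auto
    then show "\<forall>\<^sub>F t in at_infinity. ext_log (cmod (dirichlet_sum a (Complex \<sigma> t))) / ereal (ln \<bar>t\<bar>)
                \<le> ereal (ln M' / ln \<bar>t\<bar> + \<alpha>)"
    proof eventually_elim
      case (elim t)
      define y where "y = cmod (dirichlet_sum a (Complex \<sigma> t))"
      have lt: "ln \<bar>t\<bar> > 0" using elim by simp
      have "y \<le> M' * \<bar>t\<bar> powr \<alpha>"
        using assms[of t] elim order_trans[OF _ mult_right_mono[of M M' "\<bar>t\<bar> powr \<alpha>"]]
        by (simp add: y_def M'_def)
      then have "y = 0 \<or> ln y \<le> ln (M' * \<bar>t\<bar> powr \<alpha>)"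
        by (cases "y = 0") (auto simp: y_def intro!: ln_mono)
      moreover have "ln (M' * \<bar>t\<bar> powr \<alpha>) = ln M' + \<alpha> * ln \<bar>t\<bar>"
        using elim by (subst ln_mult) (auto simp: M'_def ln_powr)
      ultimately have "y = 0 \<or> ln y / ln \<bar>t\<bar> \<le> ln M' / ln \<bar>t\<bar> + \<alpha>"
        using lt by (auto simp: field_simps)
      then show ?case
        unfolding y_def[symmetric] using lt by (auto simp: ext_log_def)
    qed
  qed
  also have "\<dots> = ereal \<alpha>" by (intro lim_imp_Limsup lim) (simp add: trivial_limit_at_infinity)
  finally show ?thesis .
qed

lemma lindelof_order_ge:
  fixes t r :: "nat \<Rightarrow> real"
  assumes t: "filterlim t at_top sequentially"
    and r: "\<forall>\<^sub>F k in sequentially. r k > 0 \<and> r k \<le> cmod (dirichlet_sum a (Complex \<sigma> (t k)))"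
    and lim: "(\<lambda>k. ln (r k) / ln (t k)) \<longlonglongrightarrow> \<alpha>"
  shows "ereal \<alpha> \<le> lindelof_order a \<sigma>"
proof -
  let ?F = "\<lambda>t. ext_log (cmod (dirichlet_sum a (Complex \<sigma> t))) / ereal (ln \<bar>t\<bar>)"
  have "ereal \<alpha> = Limsup sequentially (\<lambda>k. ereal (ln (r k) / ln (t k)))"
    using lim by (intro lim_imp_Limsup[symmetric]) auto
  also have "\<dots> \<le> Limsup sequentially (\<lambda>k. ?F (t k))"
  proof (rule Limsup_mono)
    from r filterlim_at_top_dense[THEN iffD1, OF t, rule_format, of 1]
    show "\<forall>\<^sub>F k in sequentially. ereal (ln (r k) / ln (t k)) \<le> ?F (t k)"
    proof eventually_elim
      case (elim k)
      then have "ln (t k) > 0" by simp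
      with elim show ?case
        by (auto simp: ext_log_def intro!: divide_right_mono)
    qed
  qed
  also have "\<dots> \<le> Limsup (filtermap t sequentially) ?F" by (rule Limsup_filtermap_ge)
  also have "\<dots> \<le> Limsup at_infinity ?F"
  proof -
    have "filtermap t sequentially \<le> at_infinity"
      using filterlim_at_top_imp_at_infinity[OF t] by (simp add: filterlim_def)
    then show ?thesis unfolding Limsup_def le_filter_def
      by (intro INF_superset_mono) auto
  qed
  finally show ?thesis by (simp add: lindelof_order_def)
qed

section \<open>Elementary inequalities\<close>

lemma norm_cis_diff_le: "cmod (cis x - cis y) \<le> \<bar>x - y\<bar>"
proof -
  have "cis x - cis y = cis y * (cis (x - y) - 1)"
    by (simp add: algebra_simps cis_mult)
  then have "cmod (cis x - cis y) = cmod (cis (x - y) - 1)" by (simp add: norm_mult)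
  also have "\<dots> = 2 * \<bar>sin ((x - y) / 2)\<bar>"
    using dist_exp_i_1[of "x - y"] by (simp add: cis_conv_exp)
  also have "\<dots> \<le> 2 * \<bar>(x - y) / 2\<bar>" by (intro mult_left_mono abs_sin_x_le_abs_x) auto
  finally show ?thesis by simp
qed

text \<open>
  By the mean value theorem \<open>sin y = y cos z\<close> with \<open>z < 1 < \<pi>/3\<close>, where the cosine is at least
  \<open>1/2\<close>.
\<close>

lemma sin_ge_half: "0 \<le> y \<Longrightarrow> y \<le> 1 \<Longrightarrow> y / 2 \<le> sin (y::real)"
proof (cases "y = 0")
  case False
  assume y: "0 \<le> y" "y \<le> 1"
  have "\<exists>z>0. z < y \<and> sin y - sin 0 = (y - 0) * cos z"
    using y False by (intro MVT2) (auto intro!: derivative_eq_intros)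
  then obtain z where z: "0 < z" "z < y" "sin y = y * cos z" by auto
  have "cos (pi / 3) \<le> cos z" using z y pi_gt3 by (intro cos_monotone_0_pi_le) auto
  then show ?thesis using z y mult_left_mono[of "1 / 2" "cos z" y] by (simp add: cos_60)
qed auto

lemma ln_step_le: "M < n \<Longrightarrow> M > 0 \<Longrightarrow> ln (real n) - ln (real (n - 1)) \<le> 1 / real M"
proof -
  assume n: "M < n" "M > 0"
  then have "ln (real n) - ln (real (n - 1)) = ln (real n / real (n - 1))"
    by (simp add: ln_div)
  also have "\<dots> \<le> real n / real (n - 1) - 1" using n by (intro ln_le_minus_one) auto
  also have "\<dots> = 1 / real (n - 1)" using n by (simp add: field_simps of_nat_diff)
  also have "\<dots> \<le> 1 / real M" using n by (intro divide_left_mono) auto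
  finally show ?thesis .
qed

lemma ln_step_ge: "1 < n \<Longrightarrow> 1 / real n \<le> ln (real n) - ln (real (n - 1))"
proof -
  assume n: "1 < n"
  have "ln (real (n - 1)) - ln (real n) = ln (real (n - 1) / real n)"
    using n by (simp add: ln_div)
  also have "\<dots> \<le> real (n - 1) / real n - 1" using n by (intro ln_le_minus_one) auto
  also have "\<dots> = - 1 / real n" using n by (simp add: field_simps of_nat_diff)
  finally show ?thesis by simp
qed

lemma sum_geometric_le: "(\<Sum>j<k. 1 / 2 ^ (j + 3)) \<le> (1 / 4 :: real)"
proof -
  have "(\<Sum>j<k. 1 / 2 ^ (j + 3)) = 1 / 4 - 1 / (2::real) ^ (k + 2)"
    by (induction k) (simp_all add: power_add field_simps)
  then show ?thesis by simp
qed

section \<open>The lacunary series\<close>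

text \<open>
  Factorials in the exponent give \<open>N\<^bsub>k+1\<^esub> = N\<^sub>k\<^bsup>k+2\<^esup>\<close>. Every fixed power of \<open>N\<^sub>k\<close> is therefore
  negligible against every fixed positive power of \<open>N\<^bsub>k+1\<^esub>\<close>.
\<close>

definition scale_at :: "nat \<Rightarrow> nat" where
  "scale_at k = 2 ^ fact (k + 1)"

text \<open>
  Multiples of \<open>2\<pi>/ln 2\<close> are exactly the \<open>T\<close> for which \<open>n\<^bsup>iT\<^esup>\<close> takes the same value at both ends
  of the block \<open>{N..2N}\<close>; rounding up costs a bounded factor.
\<close>

definition freq :: "real \<Rightarrow> nat \<Rightarrow> real" where
  "freq \<theta> k = 2 * pi / ln 2 * of_int \<lceil>real (scale_at k) powr (1 / 2 - \<theta>)\<rceil>"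

text \<open>
  The power of \<open>2\<close> is the summable factor \<open>c\<close>. It starts at \<open>1/8\<close> so that the sum of all of them,
  \<open>1/4\<close>, is smaller than \<open>1 - 2\<^bsup>-1/2\<^esup>\<close>, the least modulus of \<open>1 - 2\<^bsup>-s\<^esup>\<close> on the line
  \<open>Re s = 1/2\<close>.
\<close>

definition amplitude :: "real \<Rightarrow> nat \<Rightarrow> real" where
  "amplitude \<theta> k = sqrt (real (scale_at k)) / (2 ^ (k + 3) * freq \<theta> k)"

definition bump :: "real \<Rightarrow> nat \<Rightarrow> nat \<Rightarrow> complex" where
  "bump \<theta> k n = (if scale_at k \<le> n \<and> n \<le> 2 * scale_at k
     then of_real (amplitude \<theta> k) * (cis (freq \<theta> k * (ln (real n) - ln (real (scale_at k)))) - 1) else 0)"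

text \<open>
  The bump \<open>k\<close> vanishes at every \<open>n \<le> k\<close>, so the finite range of \<open>k\<close> loses nothing.
\<close>

definition psum :: "real \<Rightarrow> nat \<Rightarrow> complex" where
  "psum \<theta> n = (if n = 1 then 1 else 0) + (\<Sum>k<n. bump \<theta> k n)"

definition coeff :: "real \<Rightarrow> nat \<Rightarrow> complex" where
  "coeff \<theta> n = psum \<theta> n - psum \<theta> (n - 1)"

lemma scale_Suc: "scale_at (Suc k) = scale_at k ^ (k + 2)"
proof -
  have "fact (Suc k + 1) = fact (k + 1) * (k + 2)" by simp
  then show ?thesis by (simp only: scale_at_def power_mult)
qed

lemma scale_ge_power: "2 ^ (k + 1) \<le> scale_at k"
  unfolding scale_at_def by (intro power_increasing fact_ge_self) auto

lemma scale_ge_2: "2 \<le> scale_at k"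
  using order_trans[OF _ scale_ge_power[of k], of 2] by simp

lemma less_scale: "k < scale_at k"
  using scale_ge_power[of k] less_exp[of "k + 1"] by linarith

lemma scale_gap_Suc: "2 * scale_at k \<le> scale_at (Suc k)"
proof -
  have "2 * scale_at k \<le> scale_at k ^ 2"
    using scale_ge_2[of k] by (simp add: power2_eq_square)
  also have "\<dots> \<le> scale_at (Suc k)"
    unfolding scale_Suc using scale_ge_2[of k] by (intro power_increasing) auto
  finally show ?thesis .
qed

lemma scale_gap: "j < k \<Longrightarrow> 2 * scale_at j \<le> scale_at k"
proof (induction k)
  case (Suc k)
  then show ?case
    using scale_gap_Suc[of k] scale_gap_Suc[of j] by (cases "j = k") auto
qed auto

lemma cis_freq_ln2: "cis (freq \<theta> k * ln 2) = 1"
proof -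
  define m where "m = \<lceil>real (scale_at k) powr (1 / 2 - \<theta>)\<rceil>"
  have "freq \<theta> k * ln 2 = 2 * pi * of_int m" by (simp add: freq_def m_def)
  then show ?thesis by (simp only: cis_multiple_2pi Ints_of_int)
qed

locale lacunary_series =
  fixes \<theta> :: real
  assumes \<theta>: "- 1 / 2 < \<theta>" "\<theta> < 1 / 2"
begin

abbreviation "N \<equiv> \<lambda>k. real (scale_at k)"
abbreviation "T \<equiv> freq \<theta>"
abbreviation "a \<equiv> coeff \<theta>"

lemma N_ge_2: "2 \<le> N k" using scale_ge_2[of k] by linarith

lemma N_powr_ge_1: "\<alpha> \<ge> 0 \<Longrightarrow> 1 \<le> N k powr \<alpha>"
  using N_ge_2[of k] by (intro ge_one_powr_ge_zero) auto

lemma freq_ge: "N k powr (1 / 2 - \<theta>) \<le> T k"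
proof -
  have "(1::real) * N k powr (1 / 2 - \<theta>) \<le> 2 * pi / ln 2 * of_int \<lceil>N k powr (1 / 2 - \<theta>)\<rceil>"
    using pi_gt3 ln_2_less_1 by (intro mult_mono) (auto simp: field_simps)
  then show ?thesis by (simp add: freq_def)
qed

lemma freq_ge_1: "1 \<le> T k"
  using freq_ge[of k] N_powr_ge_1[of "1 / 2 - \<theta>" k] \<theta> by simp

lemma freq_le: "T k \<le> 32 * N k powr (1 / 2 - \<theta>)"
proof -
  have ln2: "ln 2 \<ge> (1 / 2 :: real)" using ln_ge_iff[of 2 "1/2"] exp_half_le2 by simp
  have "of_int \<lceil>N k powr (1 / 2 - \<theta>)\<rceil> \<le> 2 * N k powr (1 / 2 - \<theta>)"
    using N_powr_ge_1[of "1 / 2 - \<theta>" k] \<theta> by linarith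
  moreover have "2 * pi / ln 2 \<le> 16"
    using ln2 pi_less_4 by (simp add: field_simps)
  ultimately have "T k \<le> 16 * (2 * N k powr (1 / 2 - \<theta>))"
    unfolding freq_def using N_powr_ge_1[of "1 / 2 - \<theta>" k] \<theta> by (intro mult_mono) auto
  then show ?thesis by simp
qed

lemma amplitude_pos: "amplitude \<theta> k > 0"
  using freq_ge_1[of k] scale_ge_2[of k] by (simp add: amplitude_def)

lemma amplitude_freq: "amplitude \<theta> k * T k = sqrt (N k) / 2 ^ (k + 3)"
  using freq_ge_1[of k] by (simp add: amplitude_def)

lemma bump_eq_0: "n \<le> scale_at k \<or> 2 * scale_at k \<le> n \<Longrightarrow> bump \<theta> k n = 0"
proof -
  have "ln (real (2 * scale_at k)) - ln (real (scale_at k)) = ln 2"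
    using scale_ge_2[of k] by (simp add: ln_mult)
  then show "n \<le> scale_at k \<or> 2 * scale_at k \<le> n \<Longrightarrow> bump \<theta> k n = 0"
    by (auto simp: bump_def cis_freq_ln2 dest: antisym)
qed

text \<open>
  Neighbouring blocks share at most an end point, where every bump is zero.
\<close>

lemma psum_block:
  assumes "scale_at k \<le> n" "n \<le> 2 * scale_at k"
  shows "psum \<theta> n = bump \<theta> k n"
proof -
  have "bump \<theta> j n = (if j = k then bump \<theta> k n else 0)" for j
    using scale_gap[of j k] scale_gap[of k j] assms
    by (cases j k rule: linorder_cases) (auto intro: bump_eq_0)
  then have "(\<Sum>j<n. bump \<theta> j n) = (\<Sum>j<n. if j = k then bump \<theta> k n else 0)" by simp
  also have "\<dots> = bump \<theta> k n" using less_scale[of k] assms by simp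
  finally show ?thesis using scale_ge_2[of k] assms by (simp add: psum_def)
qed

lemma psum_nonzeroD:
  assumes "psum \<theta> n \<noteq> 0" "n \<noteq> 1"
  shows "\<exists>k. scale_at k < n \<and> n < 2 * scale_at k"
proof -
  have "\<exists>k<n. bump \<theta> k n \<noteq> 0" using assms by (auto simp: psum_def intro: sum.neutral)
  then show ?thesis using bump_eq_0 not_le by metis
qed

lemma psum_0 [simp]: "psum \<theta> 0 = 0" by (simp add: psum_def)

lemma psum_1 [simp]: "psum \<theta> (Suc 0) = 1"
  using bump_eq_0[of "Suc 0" 0] scale_ge_2[of 0] by (simp add: psum_def)

lemma psum_2 [simp]: "psum \<theta> 2 = 0"
  using psum_nonzeroD[of 2] scale_ge_2 by (metis not_le numeral_One numeral_eq_iff semiring_norm(85))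

lemma coeff_nonzeroD:
  assumes "a n \<noteq> 0" "n > 2"
  shows "\<exists>k. scale_at k < n \<and> n \<le> 2 * scale_at k"
proof -
  consider "psum \<theta> n \<noteq> 0" | "psum \<theta> (n - 1) \<noteq> 0" using assms by (metis coeff_def diff_self)
  then show ?thesis
  proof cases
    case 1
    from psum_nonzeroD[OF this] assms show ?thesis by fastforce
  next
    case 2
    moreover have "n - 1 \<noteq> 1" using assms by linarith
    ultimately obtain k where "scale_at k < n - 1" "n - 1 < 2 * scale_at k" using psum_nonzeroD by blast
    then show ?thesis by (intro exI[of _ k]) linarith
  qed
qed

lemma coeff_gap: "2 * scale_at k < n \<Longrightarrow> n \<le> scale_at (Suc k) \<Longrightarrow> a n = 0"
proof (rule ccontr)
  assume n: "2 * scale_at k < n" "n \<le> scale_at (Suc k)" and "a n \<noteq> 0"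
  moreover have "n > 2" using n scale_ge_2[of k] by linarith
  ultimately obtain j where "scale_at j < n" "n \<le> 2 * scale_at j" using coeff_nonzeroD by blast
  with n scale_gap[of j k] scale_gap[of "Suc k" j] scale_gap_Suc[of k] show False
    by (cases j k rule: linorder_cases) (auto simp: less_Suc_eq_le le_less Suc_less_eq dest!: Suc_leI)
qed

lemma coeff_block:
  assumes "scale_at k < n" "n \<le> 2 * scale_at k"
  shows "a n = of_real (amplitude \<theta> k) *
    (cis (T k * (ln (real n) - ln (N k))) - cis (T k * (ln (real (n - 1)) - ln (N k))))"
proof -
  have "scale_at k \<le> n" "scale_at k \<le> n - 1" "n - 1 \<le> 2 * scale_at k" using assms by auto
  then show ?thesis
    using assms(2) psum_block[of k n] psum_block[of k "n - 1"]
    by (simp add: coeff_def bump_def right_diff_distrib)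
qed

text \<open>
  One step of \<open>n\<^bsup>iT\<^esup>\<close> turns by an angle of at most \<open>T/N\<close>, and the \<open>T\<close> cancels against the one in
  the amplitude.
\<close>

lemma norm_coeff_block:
  assumes "scale_at k < n" "n \<le> 2 * scale_at k"
  shows "cmod (a n) \<le> 1 / (2 ^ (k + 3) * sqrt (N k))"
proof -
  have step: "0 \<le> ln (real n) - ln (real (n - 1))" "ln (real n) - ln (real (n - 1)) \<le> 1 / N k"
    using assms scale_ge_2[of k] ln_step_le[of "scale_at k" n] by auto
  have "cmod (a n) \<le> amplitude \<theta> k * (T k * (ln (real n) - ln (real (n - 1))))"
    unfolding coeff_block[OF assms] norm_mult
    using amplitude_pos[of k] freq_ge_1[of k] step
    by (intro mult_mono order_trans[OF norm_cis_diff_le]) (auto simp: right_diff_distrib[symmetric] abs_mult)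
  also have "\<dots> \<le> amplitude \<theta> k * T k * (1 / N k)"
    using amplitude_pos[of k] freq_ge_1[of k] step unfolding mult.assoc by (intro mult_left_mono) auto
  also have "\<dots> = 1 / (2 ^ (k + 3) * sqrt (N k))"
    unfolding amplitude_freq using scale_ge_2[of k] by (simp add: field_simps)
  finally show ?thesis .
qed

lemma coeff_1: "a (Suc 0) = 1" and coeff_2: "a 2 = - 1"
  by (auto simp: coeff_def)

lemma norm_coeff_le:
  assumes "n \<ge> 1"
  shows "cmod (a n) \<le> 2 * real n powr (- 1 / 2)"
proof -
  have eq: "real n powr (- 1 / 2) = 1 / sqrt (real n)"
    using assms powr_minus_divide[of "real n" "1 / 2"] by (simp add: powr_half_sqrt)
  consider "n = 1" | "n = 2" | "n > 2" "a n = 0" | "n > 2" "a n \<noteq> 0" using assms by linarith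
  then show ?thesis
  proof cases
    case 2
    have "sqrt 2 \<le> (2::real)" by (rule real_le_lsqrt) auto
    then show ?thesis unfolding eq using 2 by (simp add: coeff_2 field_simps)
  next
    case 4
    then obtain k where k: "scale_at k < n" "n \<le> 2 * scale_at k" using coeff_nonzeroD by blast
    have "1 / (2 ^ (k + 3) * sqrt (N k)) \<le> 1 / (1 * sqrt (N k))"
      using scale_ge_2[of k] by (intro divide_left_mono mult_right_mono) auto
    also have "\<dots> = 2 / sqrt (4 * N k)" by (simp add: real_sqrt_mult)
    also have "\<dots> \<le> 2 / sqrt (real n)" using k by (intro divide_left_mono) auto
    finally show ?thesis unfolding eq using norm_coeff_block[OF k] by simp
  qed (use coeff_1 in \<open>auto simp: eq\<close>)
qed

lemma sum_coeff: "(\<Sum>m<n. dirichlet_term a 0 (Suc m)) = psum \<theta> n"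
proof -
  have "dirichlet_term a 0 (Suc m) = psum \<theta> (Suc m) - psum \<theta> m" for m
    by (simp add: dirichlet_term_def coeff_def del: of_nat_Suc)
  then show ?thesis by (simp add: sum_lessThan_telescope)
qed

text \<open>
  On a block the amplitude is at most \<open>N\<^bsup>1/2\<^esup>/T \<le> N\<^sup>\<theta>\<close>. As \<open>n + 1 \<le> 4 N\<close> and \<open>\<theta> > -1/2\<close>, replacing
  \<open>N\<close> by \<open>n + 1\<close> costs at most a factor \<open>2\<close>, whatever the sign of \<open>\<theta>\<close>.
\<close>

lemma norm_psum_le: "cmod (psum \<theta> n) \<le> 4 * real (n + 1) powr \<theta>"
proof -
  have four: "1 / 2 \<le> (4::real) powr \<theta>"
  proof -
    have "(4::real) powr (- 1 / 2) \<le> 4 powr \<theta>" using \<theta> by (intro powr_mono) auto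
    moreover have "(4::real) powr (- 1 / 2) = 1 / 2"
      using powr_minus_divide[of "4::real" "1 / 2"] by (simp add: powr_half_sqrt)
    ultimately show ?thesis by linarith
  qed
  have comparable: "x powr \<theta> / 2 \<le> y powr \<theta>" if "1 \<le> x" "x \<le> y" "y \<le> 4 * x" for x y :: real
  proof (cases "\<theta> \<ge> 0")
    case True
    then have "x powr \<theta> \<le> y powr \<theta>" using that by (intro powr_mono2) auto
    then show ?thesis using powr_ge_zero[of x \<theta>] by linarith
  next
    case False
    have "x powr \<theta> / 2 \<le> 4 powr \<theta> * x powr \<theta>" using mult_right_mono[OF four, of "x powr \<theta>"] by simp
    also have "\<dots> = (4 * x) powr \<theta>" using that by (simp add: powr_mult)
    also have "\<dots> \<le> y powr \<theta>" using that False by (intro powr_mono2') auto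
    finally show ?thesis .
  qed
  consider "psum \<theta> n = 0" | "n = 1" | "psum \<theta> n \<noteq> 0" "n \<noteq> 1" by blast
  then show ?thesis
  proof cases
    case 2
    then show ?thesis using comparable[of 1 2] by simp
  next
    case 3
    then obtain k where k: "scale_at k < n" "n < 2 * scale_at k" using psum_nonzeroD by blast
    then have "psum \<theta> n = of_real (amplitude \<theta> k) * (cis (T k * (ln (real n) - ln (N k))) - 1)"
      using psum_block[of k n] by (simp add: bump_def)
    then have "cmod (psum \<theta> n) = amplitude \<theta> k * cmod (cis (T k * (ln (real n) - ln (N k))) - 1)"
      using amplitude_pos[of k] by (simp add: norm_mult)
    also have "\<dots> \<le> amplitude \<theta> k * 2"
      using amplitude_pos[of k] by (intro mult_left_mono order_trans[OF norm_triangle_ineq4]) auto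
    also have "amplitude \<theta> k \<le> N k powr (1 / 2) / (1 * N k powr (1 / 2 - \<theta>))"
      unfolding amplitude_def using freq_ge[of k] freq_ge_1[of k] scale_ge_2[of k]
      by (intro frac_le mult_mono) (auto simp: powr_half_sqrt)
    also have "\<dots> = N k powr \<theta>" by (simp add: powr_diff[symmetric])
    also have "N k powr \<theta> * 2 \<le> 4 * real (n + 1) powr \<theta>"
      using comparable[of "N k" "real (n + 1)"] k N_ge_2[of k] by simp
    finally show ?thesis by simp
  qed simp
qed

text \<open>
  Each block has \<open>N\<close> terms, each of size at most \<open>c N\<^bsup>-1/2\<^esup> N\<^bsup>-1/2\<^esup>\<close>, and so contributes at most \<open>c\<close>.
\<close>

lemma weighted_sum_le:
  "(\<Sum>n\<in>{2<..scale_at k}. cmod (a n) * real n powr (- 1 / 2)) \<le> (\<Sum>j<k. 1 / 2 ^ (j + 3))"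
proof (induction k)
  case 0
  then show ?case by (simp add: scale_at_def)
next
  case (Suc k)
  let ?f = "\<lambda>n. cmod (a n) * real n powr (- 1 / 2)"
  have split: "{2<..scale_at (Suc k)} = {2<..scale_at k} \<union> {scale_at k<..2 * scale_at k} \<union> {2 * scale_at k<..scale_at (Suc k)}"
    using scale_ge_2[of k] scale_gap_Suc[of k] by auto
  have "sum ?f {2<..scale_at (Suc k)} =
      sum ?f {2<..scale_at k} + sum ?f {scale_at k<..2 * scale_at k} + sum ?f {2 * scale_at k<..scale_at (Suc k)}"
    unfolding split by (subst sum.union_disjoint; (subst sum.union_disjoint)?) auto
  also have "sum ?f {2 * scale_at k<..scale_at (Suc k)} = 0" using coeff_gap by (intro sum.neutral) auto
  also have "sum ?f {scale_at k<..2 * scale_at k} \<le> (\<Sum>n\<in>{scale_at k<..2 * scale_at k}. 1 / 2 ^ (k + 3) / N k)"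
  proof (rule sum_mono)
    fix n assume n: "n \<in> {scale_at k<..2 * scale_at k}"
    have "?f n \<le> 1 / (2 ^ (k + 3) * sqrt (N k)) * N k powr (- 1 / 2)"
      using n norm_coeff_block[of k n] scale_ge_2[of k] by (intro mult_mono powr_mono2') auto
    also have "N k powr (- 1 / 2) = 1 / sqrt (N k)"
      using powr_minus_divide[of "N k" "1 / 2"] by (simp add: powr_half_sqrt)
    also have "1 / (2 ^ (k + 3) * sqrt (N k)) * (1 / sqrt (N k)) = 1 / 2 ^ (k + 3) / (sqrt (N k) * sqrt (N k))"
      by simp
    also have "sqrt (N k) * sqrt (N k) = N k" by simp
    finally show "?f n \<le> 1 / 2 ^ (k + 3) / N k" .
  qed
  also have "\<dots> = 1 / 2 ^ (k + 3)" using scale_ge_2[of k] by simp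
  finally show ?case using Suc by simp
qed

lemma weighted_sum_tail_le:
  "(\<Sum>m<n. cmod (a (m + 3)) * real (m + 3) powr (- 1 / 2)) \<le> 1 / 4"
proof -
  let ?f = "\<lambda>n. cmod (a n) * real n powr (- 1 / 2)"
  have "(\<Sum>m<n. ?f (m + 3)) = sum ?f ((\<lambda>m. m + 3) ` {..<n})"
    by (subst sum.reindex) (auto simp: inj_on_def)
  also have "\<dots> \<le> sum ?f {2<..scale_at (n + 3)}"
    using less_scale[of "n + 3"] by (intro sum_mono2) auto
  also have "\<dots> \<le> 1 / 4" by (rule order_trans[OF weighted_sum_le sum_geometric_le])
  finally show ?thesis .
qed

lemma summable_weighted: "summable (\<lambda>n. cmod (a (Suc n)) * real (Suc n) powr (- 1 / 2))"
proof -
  have "summable (\<lambda>m. cmod (a (m + 3)) * real (m + 3) powr (- 1 / 2))"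
    by (rule bounded_imp_summable[where B = "1 / 4"])
       (use weighted_sum_tail_le in \<open>auto simp: lessThan_Suc_atMost[symmetric] simp del: sum.lessThan_Suc\<close>)
  then show ?thesis
    by (subst summable_iff_shift[of _ 2, symmetric]) (simp add: eval_nat_numeral)
qed

text \<open>
  Square summability follows from absolute convergence on \<open>Re s = 1/2\<close>, because
  \<open>\<bar>a\<^sub>n\<bar>\<^sup>2 \<le> 2 n\<^bsup>-1/2\<^esup> \<bar>a\<^sub>n\<bar>\<close>.
\<close>

lemma coeff_in_H2: "a \<in> hardy_H2"
proof -
  have "summable (\<lambda>n. (cmod (a (Suc n)))\<^sup>2)"
  proof (rule summable_comparison_test'[OF summable_mult[OF summable_weighted, of 2], of 0])
    fix n :: nat
    have "cmod (a (Suc n)) * cmod (a (Suc n)) \<le> (2 * real (Suc n) powr (- 1 / 2)) * cmod (a (Suc n))"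
      by (intro mult_right_mono norm_coeff_le) auto
    then show "norm ((cmod (a (Suc n)))\<^sup>2) \<le> 2 * (cmod (a (Suc n)) * real (Suc n) powr (- 1 / 2))"
      by (simp add: power2_eq_square mult_ac)
  qed
  then show ?thesis by (simp add: hardy_H2_def)
qed

lemma abs_summable_half:
  assumes "Re s = 1 / 2"
  shows "summable (\<lambda>n. cmod (dirichlet_term a s (Suc n)))"
proof -
  have "cmod (dirichlet_term a s (Suc n)) = cmod (a (Suc n)) * real (Suc n) powr (- 1 / 2)" for n
    by (simp add: norm_dirichlet_term assms del: of_nat_Suc)
  then show ?thesis using summable_weighted by simp
qed

text \<open>
  The first two terms are \<open>1 - 2\<^bsup>-s\<^esup>\<close>, of modulus at least \<open>1 - 2\<^bsup>-1/2\<^esup> > 29/100\<close>, and all the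
  others together contribute at most \<open>1/4\<close>.
\<close>

lemma dirichlet_sum_half:
  assumes "Re s = 1 / 2"
  shows "1 / 25 \<le> cmod (dirichlet_sum a s)" and "cmod (dirichlet_sum a s) \<le> 3"
proof -
  let ?f = "\<lambda>n. dirichlet_term a s (Suc n)"
  have sf: "summable (\<lambda>n. cmod (?f n))" by (rule abs_summable_half[OF assms])
  define R where "R = (\<Sum>n. ?f (n + 2))"
  define q where "q = (2::complex) powr (- s)"
  have split: "dirichlet_sum a s = (1 - q) + R"
    unfolding dirichlet_sum_def
    using suminf_split_initial_segment[OF summable_norm_cancel[OF sf], of 2]
    by (simp add: R_def q_def eval_nat_numeral dirichlet_term_def coeff_1 coeff_2[unfolded numeral_2_eq_2])
  have sR: "summable (\<lambda>n. cmod (?f (n + 2)))" using sf by (subst summable_iff_shift)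
  have "cmod R \<le> (\<Sum>n. cmod (?f (n + 2)))" unfolding R_def by (rule summable_norm[OF sR])
  also have "\<dots> \<le> 1 / 4"
  proof (rule suminf_le_const[OF sR])
    fix n
    have "(\<Sum>m<n. cmod (?f (m + 2))) = (\<Sum>m<n. cmod (a (m + 3)) * real (m + 3) powr (- 1 / 2))"
      by (intro sum.cong) (simp_all add: norm_dirichlet_term assms eval_nat_numeral)
    then show "(\<Sum>m<n. cmod (?f (m + 2))) \<le> 1 / 4" using weighted_sum_tail_le[of n] by simp
  qed
  finally have R: "cmod R \<le> 1 / 4" .
  have "cmod q = 2 powr (- 1 / 2)" by (simp add: q_def assms norm_powr_real_powr)
  also have "\<dots> = 1 / sqrt 2" using powr_minus_divide[of "2::real" "1 / 2"] by (simp add: powr_half_sqrt)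
  also have "\<dots> \<le> 71 / 100"
  proof -
    have "100 / 71 \<le> sqrt (2::real)" by (rule real_le_rsqrt) (simp add: power2_eq_square)
    then show ?thesis by (simp add: field_simps)
  qed
  finally have q: "cmod q \<le> 71 / 100" .
  show "1 / 25 \<le> cmod (dirichlet_sum a s)"
    using R q norm_diff_ineq[of "1 - q" R] norm_triangle_ineq2[of 1 q] unfolding split by simp
  show "cmod (dirichlet_sum a s) \<le> 3"
    using R q norm_triangle_ineq[of "1 - q" R] norm_triangle_ineq4[of 1 q] unfolding split by simp
qed

section \<open>Resonance\<close>

text \<open>
  After rotation by \<open>\<omega> = N\<^bsup>iT\<^esup>\<close> the term with index \<open>n\<close> is the positive number
  \<open>c N\<^bsup>1/2\<^esup>/T n\<^bsup>-\<sigma>\<^esup>\<close> times \<open>1 - e\<^bsup>-iy\<^esup>\<close>, where \<open>y = T ln (n/(n-1))\<close> is a small positive angle.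
  Its imaginary part \<open>sin y\<close> is at least \<open>y/2\<close>, hence at least \<open>T/(4N)\<close>, so that the imaginary
  parts of the \<open>N\<close> rotated terms add up without cancellation.
\<close>

lemma block_lower_bound:
  assumes \<sigma>: "- 1 / 2 < \<sigma>" "\<sigma> < 1 / 2" and T: "T k \<le> N k"
  shows "N k powr (1 / 2 - \<sigma>) / 2 ^ (k + 6)
     \<le> cmod (\<Sum>n\<in>{scale_at k<..2 * scale_at k}. dirichlet_term a (Complex \<sigma> (T k)) n)"
proof -
  let ?B = "{scale_at k<..2 * scale_at k}"
  let ?d = "\<lambda>n. dirichlet_term a (Complex \<sigma> (T k)) n"
  define \<omega> where "\<omega> = cis (T k * ln (N k))"
  have N: "N k \<ge> 2" by (rule N_ge_2)
  have each: "amplitude \<theta> k * T k * N k powr (- \<sigma>) / (8 * N k) \<le> Im (\<omega> * ?d n)" if n: "n \<in> ?B" for n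
  proof -
    define y where "y = T k * (ln (real n) - ln (real (n - 1)))"
    have n': "scale_at k < n" "n \<le> 2 * scale_at k" "n \<ge> 1" using n by auto
    have "y \<le> T k * (1 / N k)"
      unfolding y_def using ln_step_le[of "scale_at k" n] n' N freq_ge_1[of k]
      by (intro mult_left_mono) auto
    also have "\<dots> \<le> 1" using T N by (simp add: field_simps)
    finally have y1: "y \<le> 1" .
    have "T k / (2 * N k) \<le> T k * (1 / real n)"
      using n' N freq_ge_1[of k] by (simp add: field_simps)
    also have "\<dots> \<le> y"
      unfolding y_def using ln_step_ge[of n] n' N freq_ge_1[of k]
      by (intro mult_left_mono) auto
    finally have y2: "T k / (2 * N k) \<le> y" .
    have y0: "0 \<le> y" using y2 N freq_ge_1[of k] order_trans[of 0 "T k / (2 * N k)" y] by simp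
    have "N k powr (- \<sigma>) / 2 \<le> real n powr (- \<sigma>)"
    proof (cases "\<sigma> \<le> 0")
      case True
      then have "N k powr (- \<sigma>) \<le> real n powr (- \<sigma>)" using n' by (intro powr_mono2) auto
      then show ?thesis using powr_ge_zero[of "N k" "- \<sigma>"] by linarith
    next
      case False
      have "(2::real) powr (- 1) \<le> 2 powr (- \<sigma>)" using \<sigma> by (intro powr_mono) auto
      then have "N k powr (- \<sigma>) * (1 / 2) \<le> N k powr (- \<sigma>) * 2 powr (- \<sigma>)"
        by (intro mult_left_mono) (auto simp: powr_minus)
      also have "\<dots> = (2 * N k) powr (- \<sigma>)" by (simp add: powr_mult)
      also have "\<dots> \<le> real n powr (- \<sigma>)" using False n' N by (intro powr_mono2') auto
      finally show ?thesis by simp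
    qed
    note w = this
    have "\<omega> * ?d n = of_real (amplitude \<theta> k * real n powr (- \<sigma>)) *
        (cis (T k * ln (N k)) * cis (- T k * ln (real n)) *
          (cis (T k * (ln (real n) - ln (N k))) - cis (T k * (ln (real (n - 1)) - ln (N k)))))"
      unfolding \<omega>_def dirichlet_term_def powr_minus_Complex[OF n'(3)] coeff_block[OF n'(1,2)]
      by (simp add: mult_ac)
    also have "cis (T k * ln (N k)) * cis (- T k * ln (real n)) *
          (cis (T k * (ln (real n) - ln (N k))) - cis (T k * (ln (real (n - 1)) - ln (N k)))) = 1 - cis (- y)"
      by (simp add: y_def right_diff_distrib cis_mult algebra_simps)
    finally have "Im (\<omega> * ?d n) = amplitude \<theta> k * real n powr (- \<sigma>) * sin y"
      by (simp add: Im_complex_of_real)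
    moreover have "amplitude \<theta> k * (N k powr (- \<sigma>) / 2) * (T k / (4 * N k)) \<le> amplitude \<theta> k * real n powr (- \<sigma>) * sin y"
      using w sin_ge_half[OF y0 y1] y2 amplitude_pos[of k] freq_ge_1[of k] N
      by (intro mult_mono) auto
    ultimately show ?thesis by (simp add: mult_ac)
  qed
  have "N k powr (1 / 2 - \<sigma>) / 2 ^ (k + 6) = sqrt (N k) / 2 ^ (k + 3) * N k powr (- \<sigma>) / 8"
    using powr_add[of "N k" "1 / 2" "- \<sigma>"] by (simp add: powr_half_sqrt power_add)
  also have "\<dots> = (\<Sum>n\<in>?B. amplitude \<theta> k * T k * N k powr (- \<sigma>) / (8 * N k))"
    unfolding amplitude_freq using N by simp
  also have "\<dots> \<le> (\<Sum>n\<in>?B. Im (\<omega> * ?d n))" by (intro sum_mono each)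
  also have "\<dots> = Im (\<omega> * sum ?d ?B)" by (simp only: sum_distrib_left Im_sum)
  also have "\<dots> \<le> cmod (\<omega> * sum ?d ?B)" by (rule order_trans[OF abs_ge_self abs_Im_le_cmod])
  also have "\<dots> = cmod (sum ?d ?B)" by (simp add: norm_mult \<omega>_def)
  finally show ?thesis .
qed

lemma sum_split_blocks:
  "(\<Sum>m<scale_at (k + 2). d (Suc m)) = (\<Sum>m<2 * scale_at k. d (Suc m)) +
     (\<Sum>n\<in>{2 * scale_at k<..scale_at (Suc k)}. d n) +
     (\<Sum>n\<in>{scale_at (Suc k)<..2 * scale_at (Suc k)}. d n) +
     (\<Sum>n\<in>{2 * scale_at (Suc k)<..scale_at (k + 2)}. d n :: complex)"
proof -
  have shift: "(\<Sum>m<n. d (Suc m)) = sum d {0<..n}" for n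
    using sum.reindex[of Suc "{..<n}" d] image_Suc_lessThan[of n]
    by (simp add: atLeastSucAtMost_greaterThanAtMost[of 0, simplified])
  have glue: "sum d {i<..j} + sum d {j<..l} = sum d {i<..l}" if "i \<le> j" "j \<le> l" for i j l
    using that by (subst sum.union_disjoint[symmetric]) (auto simp: ivl_disj_un_two)
  show ?thesis
    unfolding shift using scale_gap_Suc[of k] scale_gap_Suc[of "Suc k"] scale_ge_2[of k] scale_ge_2[of "Suc k"]
    by (simp add: glue)
qed

text \<open>
  Let \<open>N = x\<^bsup>k+2\<^esup>\<close> be the scale of the resonating block, where \<open>x\<close> is the scale before it. The
  nonzero terms before it have indices up to \<open>2x\<close> and contribute at most a constant times \<open>x\<^bsup>1/2-\<sigma>\<^esup>\<close>. The later ones lie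
  beyond the next scale \<open>N\<^bsup>k+3\<^esup>\<close>, and their tail estimate overcomes the factor
  \<open>T \<le> N\<close> and stays bounded. For large \<open>k\<close> the resonating block exceeds both, since
  \<open>N\<^bsup>1/2-\<sigma>\<^esup>\<close> is a growing power of \<open>x\<close> while the factor \<open>2\<^bsup>-k-8\<^esup> \<ge> x\<^bsup>-8\<^esup>\<close> costs only a fixed one.
\<close>

lemma resonance:
  assumes \<sigma>: "\<theta> < \<sigma>" "\<sigma> < 1 / 2"
  shows "\<forall>\<^sub>F k in sequentially.
     N k powr (1 / 2 - \<sigma>) / 2 ^ (k + 7) \<le> cmod (dirichlet_sum a (Complex \<sigma> (T k)))"
proof -
  define L where "L = 1 / 2 - \<sigma>"
  define \<delta> where "\<delta> = \<sigma> - \<theta>"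
  define \<beta> where "\<beta> = 1 / 2 - \<theta>"
  define C\<^sub>1 where "C\<^sub>1 = 2 / L * 2 powr L"
  define C\<^sub>2 where "C\<^sub>2 = 4 * (1 + (\<bar>\<sigma>\<bar> + 1) * 2 powr (\<sigma> + 1) / (\<sigma> - \<theta>))"
  have pos: "L > 0" "\<delta> > 0" "\<beta> > 0" "\<beta> < 1" "C\<^sub>1 > 0" "C\<^sub>2 > 0"
    using \<sigma> \<theta> by (auto simp: L_def \<delta>_def \<beta>_def C\<^sub>1_def C\<^sub>2_def add_pos_nonneg)
  \<comment> \<open>Each summand of \<open>n\<^sub>0\<close> secures one of the four inequalities called \<open>big\<close> below.\<close>
  define n\<^sub>0 where "n\<^sub>0 = nat \<lceil>(1 + L) / L + 9 / L\<rceil> + nat \<lceil>1 / \<delta>\<rceil> + nat \<lceil>C\<^sub>1 + C\<^sub>2\<rceil> + nat \<lceil>32 powr (1 / (1 - \<beta>))\<rceil>"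
  have "N (Suc k) powr (1 / 2 - \<sigma>) / 2 ^ (Suc k + 7) \<le> cmod (dirichlet_sum a (Complex \<sigma> (T (Suc k))))"
    if k: "k \<ge> n\<^sub>0" for k
  proof -
    define x where "x = N k"
    define K where "K = Suc k"
    define s where "s = Complex \<sigma> (T K)"
    let ?d = "dirichlet_term a s"
    have "real k < real (scale_at k)" using less_scale[of k] by linarith
    then have kx: "real k < x" by (simp add: x_def)
    have x2: "x \<ge> 2" using N_ge_2 by (simp add: x_def)
    have big: "9 + L \<le> real (k + 2) * L" "1 \<le> real k * \<delta>" "C\<^sub>1 + C\<^sub>2 \<le> x" "32 powr (1 / (1 - \<beta>)) \<le> x"
    proof -
      have "(1 + L) / L + 9 / L \<le> real k" "1 / \<delta> \<le> real k" "C\<^sub>1 + C\<^sub>2 \<le> real k" "32 powr (1 / (1 - \<beta>)) \<le> real k"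
        using k unfolding n\<^sub>0_def by linarith+
      from this(1) have "(10 + L) / L \<le> real k" by (simp add: add_divide_distrib[symmetric])
      then show "9 + L \<le> real (k + 2) * L" using pos by (simp add: field_simps)
      show "1 \<le> real k * \<delta>" using \<open>1 / \<delta> \<le> real k\<close> pos by (simp add: field_simps)
      show "C\<^sub>1 + C\<^sub>2 \<le> x" using \<open>C\<^sub>1 + C\<^sub>2 \<le> real k\<close> kx by linarith
      show "32 powr (1 / (1 - \<beta>)) \<le> x" using \<open>32 powr (1 / (1 - \<beta>)) \<le> real k\<close> kx by linarith
    qed
    have NK: "N K = x ^ (k + 2)" by (simp add: K_def x_def scale_Suc)
    have NK_powr: "N K = x powr real (k + 2)" unfolding NK using x2 by (subst powr_realpow) auto
    have xNK: "x \<le> N K" unfolding NK using x2 self_le_power[of x "k + 2"] by simp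
    have TK: "T K \<le> N K"
    proof -
      have "32 = (32 powr (1 / (1 - \<beta>))) powr (1 - \<beta>)" using pos by (simp add: powr_powr)
      also have "\<dots> \<le> N K powr (1 - \<beta>)" using big(4) xNK pos by (intro powr_mono2) auto
      finally have "32 * N K powr \<beta> \<le> N K powr (1 - \<beta>) * N K powr \<beta>" by (intro mult_right_mono) auto
      also have "\<dots> = N K" using N_ge_2[of K] by (simp add: powr_add[symmetric])
      finally show ?thesis using freq_le[of K] by (simp add: \<beta>_def)
    qed
    define block where "block = sum ?d {scale_at K<..2 * scale_at K}"
    define head where "head = (\<Sum>m<2 * scale_at k. ?d (Suc m))"
    have gap: "sum ?d {2 * scale_at j<..scale_at (Suc j)} = 0" for j
      using coeff_gap[of j] by (intro sum.neutral) (auto simp: dirichlet_term_def)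
    have split: "(\<Sum>m<scale_at (Suc K). ?d (Suc m)) = head + block"
      using sum_split_blocks[of ?d k] gap[of k] gap[of K] by (simp add: head_def block_def K_def)
    have block: "N K powr L / 2 ^ (K + 6) \<le> cmod block"
      unfolding block_def s_def L_def by (rule block_lower_bound) (use \<sigma> \<theta> TK in auto)
    have head: "cmod head \<le> C\<^sub>1 * x powr L"
    proof -
      have "cmod head \<le> 2 / (1 / 2 - Re s) * real (2 * scale_at k) powr (1 / 2 - Re s)"
        unfolding head_def by (rule dirichlet_head[OF norm_coeff_le]) (use \<sigma> \<theta> in \<open>auto simp: s_def\<close>)
      also have "\<dots> = C\<^sub>1 * x powr L" by (simp add: C\<^sub>1_def s_def L_def x_def powr_mult)
      finally show ?thesis .
    qed
    have tail: "cmod (dirichlet_sum a s - (head + block)) \<le> C\<^sub>2"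
    proof -
      have s: "1 + cmod s * 2 powr (\<sigma> + 1) / (\<sigma> - \<theta>) \<le> (1 + (\<bar>\<sigma>\<bar> + 1) * 2 powr (\<sigma> + 1) / (\<sigma> - \<theta>)) * N K"
      proof -
        have "cmod s \<le> \<bar>\<sigma>\<bar> + T K" using cmod_le[of s] freq_ge_1[of K] by (simp add: s_def)
        also have "\<dots> \<le> (\<bar>\<sigma>\<bar> + 1) * N K"
          using TK mult_left_mono[of 1 "N K" "\<bar>\<sigma>\<bar>"] N_ge_2[of K] by (simp add: distrib_right)
        finally have "cmod s \<le> (\<bar>\<sigma>\<bar> + 1) * N K" .
        moreover have "1 + c * p / d \<le> (1 + b * p / d) * x" if "c \<le> b * x" "0 \<le> p" "0 < d" "1 \<le> x"
          for b c d p x :: real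
        proof -
          have "c * (p / d) \<le> b * x * (p / d)" using that by (intro mult_right_mono) auto
          then have "1 + c * (p / d) \<le> x + b * x * (p / d)" using that by linarith
          then show ?thesis by (simp add: algebra_simps)
        qed
        ultimately show ?thesis using \<sigma> N_ge_2[of K] by simp
      qed
      have "cmod (dirichlet_sum a s - (\<Sum>m<scale_at (Suc K). ?d (Suc m)))
          \<le> 4 * (1 + cmod (s - 0) * 2 powr (\<sigma> + 1) / (\<sigma> - \<theta>)) * real (scale_at (Suc K) + 1) powr (\<theta> - \<sigma>)"
        by (rule dirichlet_tail) (use norm_psum_le \<sigma> \<theta> in \<open>auto simp: sum_coeff s_def\<close>)
      also have "\<dots> \<le> 4 * ((1 + (\<bar>\<sigma>\<bar> + 1) * 2 powr (\<sigma> + 1) / (\<sigma> - \<theta>)) * N K) * N (Suc K) powr (\<theta> - \<sigma>)"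
        using s \<sigma> N_ge_2[of "Suc K"] N_ge_2[of K] by (intro mult_mono powr_mono2') auto
      also have "\<dots> = C\<^sub>2 * (N K * N (Suc K) powr (- \<delta>))" by (simp add: C\<^sub>2_def \<delta>_def)
      also have "N K * N (Suc K) powr (- \<delta>) = N K powr (1 - real (K + 2) * \<delta>)"
      proof -
        have "N (Suc K) = N K powr real (K + 2)"
          using N_ge_2[of K] by (subst powr_realpow) (auto simp: scale_Suc)
        then have "N (Suc K) powr (- \<delta>) = N K powr (real (K + 2) * - \<delta>)"
          by (simp only: powr_powr)
        then show ?thesis using N_ge_2[of K] powr_add[of "N K" 1 "real (K + 2) * - \<delta>"] by simp
      qed
      also have "\<dots> \<le> N K powr 0"
      proof (rule powr_mono)
        have "real k * \<delta> \<le> real (K + 2) * \<delta>" using pos by (intro mult_right_mono) (auto simp: K_def)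
        then show "1 - real (K + 2) * \<delta> \<le> 0" using big(2) by simp
      qed (use N_ge_2[of K] in auto)
      finally show ?thesis using pos N_ge_2[of K] by (simp add: split)
    qed
    have small: "C\<^sub>1 * x powr L + C\<^sub>2 \<le> N K powr L / 2 ^ (K + 7)"
    proof -
      have "C\<^sub>1 * x powr L + C\<^sub>2 \<le> (C\<^sub>1 + C\<^sub>2) * x powr L"
        using mult_left_mono[OF ge_one_powr_ge_zero[of x L], of C\<^sub>2] x2 pos by (simp add: distrib_right)
      also have "\<dots> \<le> x powr 1 * x powr L" using big(3) x2 by (intro mult_right_mono) auto
      finally have crude: "C\<^sub>1 * x powr L + C\<^sub>2 \<le> x powr 1 * x powr L" .
      have "2 ^ (K + 7) * (C\<^sub>1 * x powr L + C\<^sub>2) \<le> x powr 8 * (x powr 1 * x powr L)"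
      proof (rule mult_mono[OF _ crude])
        have "(2::real) ^ (K + 7) \<le> 2 ^ ((k + 1) * 8)" by (intro power_increasing) (auto simp: K_def)
        also have "\<dots> = (2 ^ (k + 1)) ^ 8" by (rule power_mult)
        also have "\<dots> \<le> x ^ 8"
        proof (rule power_mono)
          have "real (2 ^ (k + 1)) \<le> x" unfolding x_def using scale_ge_power[of k] by (simp only: of_nat_le_iff)
          then show "2 ^ (k + 1) \<le> x" by simp
        qed auto
        also have "\<dots> = x powr 8" using x2 by simp
        finally show "2 ^ (K + 7) \<le> x powr 8" .
      qed (use pos x2 in auto)
      also have "\<dots> = x powr (9 + L)" by (simp only: powr_add[symmetric]) simp
      also have "\<dots> \<le> x powr (real (k + 2) * L)" using big(1) x2 by (intro powr_mono) auto
      also have "\<dots> = N K powr L" by (simp add: NK_powr powr_powr)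
      finally show ?thesis by (simp add: field_simps)
    qed
    have "N K powr L / 2 ^ (K + 7) + N K powr L / 2 ^ (K + 7) = N K powr L / 2 ^ (K + 6)"
      by (simp add: power_add)
    moreover have "cmod block \<le> cmod (dirichlet_sum a s) + cmod head + cmod (dirichlet_sum a s - (head + block))"
      using norm_triangle_ineq4[of "dirichlet_sum a s - head" "dirichlet_sum a s - (head + block)"]
        norm_triangle_ineq4[of "dirichlet_sum a s" head] by simp
    ultimately show ?thesis
      using block head tail small unfolding K_def[symmetric] s_def[symmetric] L_def[symmetric] by linarith
  qed
  then have "\<forall>\<^sub>F k in sequentially. N (Suc k) powr (1 / 2 - \<sigma>) / 2 ^ (Suc k + 7)
      \<le> cmod (dirichlet_sum a (Complex \<sigma> (T (Suc k))))"
    unfolding eventually_sequentially by blast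
  then show ?thesis by (subst (asm) eventually_sequentially_Suc)
qed

section \<open>Order and abscissas\<close>

lemma ln_N: "ln (N k) = fact (k + 1) * ln 2"
proof -
  have "ln (N k) = real (fact (k + 1)) * ln 2"
    unfolding scale_at_def of_nat_power by (subst ln_realpow) auto
  then show ?thesis by (simp only: of_nat_fact)
qed

lemma ln_N_ge: "real k * ln 2 \<le> ln (N k)"
proof -
  have "real (k + 1) \<le> real (fact (k + 1))" by (simp only: of_nat_le_iff fact_ge_self)
  then have "real k \<le> fact (k + 1)" unfolding of_nat_fact by linarith
  then show ?thesis unfolding ln_N by (intro mult_right_mono) auto
qed

lemma ln_N_at_top: "filterlim (\<lambda>k. ln (N k)) at_top sequentially"
proof (rule filterlim_at_top_mono)
  show "filterlim (\<lambda>k. real k * ln 2) at_top sequentially"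
    by (rule filterlim_at_top_mult_tendsto_pos[OF tendsto_const _ filterlim_real_sequentially]) auto
qed (use ln_N_ge in auto)

text \<open>
  On the logarithmic scale the factor \<open>2\<^bsup>-k-7\<^esup>\<close> and the rounding of the frequencies disappear:
  \<open>ln N\<close> grows like a factorial, and \<open>ln T\<close> differs from \<open>\<beta> ln N\<close> by a bounded amount.
\<close>

lemma ln_ratio_tendsto:
  "(\<lambda>k. ln (N k powr L / 2 ^ (k + 7)) / ln (T k)) \<longlonglongrightarrow> L / (1 / 2 - \<theta>)"
proof -
  define \<beta> where "\<beta> = 1 / 2 - \<theta>"
  have \<beta>: "\<beta> > 0" using \<theta> by (simp add: \<beta>_def)
  have u: "ln (N k) > 0" for k using N_ge_2[of k] by simp
  have num: "(\<lambda>k. ln (N k powr L / 2 ^ (k + 7)) / ln (N k)) \<longlonglongrightarrow> L"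
  proof -
    have eq: "ln (N k powr L / 2 ^ (k + 7)) / ln (N k) = L - real (k + 7) / fact (k + 1)" for k
    proof -
      have "ln (N k powr L / 2 ^ (k + 7)) = L * ln (N k) - real (k + 7) * ln 2"
        using N_ge_2[of k] by (simp add: ln_div ln_powr ln_realpow del: power_add)
      moreover have "real (k + 7) * ln 2 / ln (N k) = real (k + 7) / fact (k + 1)" unfolding ln_N by simp
      ultimately show ?thesis using u[of k] by (simp add: diff_divide_distrib)
    qed
    have "(\<lambda>k. real (k + 7) / fact (k + 1)) \<longlonglongrightarrow> 0"
    proof (rule tendsto_sandwich[OF _ _ tendsto_const lim_const_over_n])
      show "\<forall>\<^sub>F k in sequentially. real (k + 7) / fact (k + 1) \<le> 7 / real k"
        using eventually_gt_at_top[of 0]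
      proof eventually_elim
        case (elim k)
        have "real k \<le> real (fact k)" using fact_ge_self[of k] by (simp only: of_nat_le_iff)
        then have "real (k + 1) * real k \<le> fact (k + 1)" by simp
        then have "real (k + 7) / fact (k + 1) \<le> 7 * real (k + 1) / (real (k + 1) * real k)"
          using elim by (intro frac_le) auto
        also have "7 * real (k + 1) / (real (k + 1) * real k) = 7 / real k"
          unfolding mult.commute[of 7] by (rule mult_divide_mult_cancel_left) simp
        finally show ?case .
      qed
    qed auto
    then show ?thesis unfolding eq using tendsto_diff[OF tendsto_const[of L]] by fastforce
  qed
  have den: "(\<lambda>k. ln (T k) / ln (N k)) \<longlonglongrightarrow> \<beta>"
  proof (rule tendsto_sandwich[OF _ _ tendsto_const])
    show "\<forall>\<^sub>F k in sequentially. \<beta> \<le> ln (T k) / ln (N k)"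
    proof (intro always_eventually allI)
      fix k
      have "\<beta> * ln (N k) = ln (N k powr \<beta>)" using N_ge_2[of k] by (simp add: ln_powr)
      also have "\<dots> \<le> ln (T k)" using freq_ge[of k] N_ge_2[of k] by (intro ln_mono) (auto simp: \<beta>_def)
      finally show "\<beta> \<le> ln (T k) / ln (N k)" using u[of k] by (simp add: field_simps)
    qed
    show "\<forall>\<^sub>F k in sequentially. ln (T k) / ln (N k) \<le> \<beta> + ln 32 / ln (N k)"
    proof (intro always_eventually allI)
      fix k
      have "ln (T k) \<le> ln (32 * N k powr \<beta>)" using freq_le[of k] freq_ge_1[of k] by (intro ln_mono) (auto simp: \<beta>_def)
      also have "\<dots> = ln 32 + \<beta> * ln (N k)" using N_ge_2[of k] by (simp add: ln_mult ln_powr)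
      finally have "ln (T k) / ln (N k) \<le> (ln 32 + \<beta> * ln (N k)) / ln (N k)"
        using u[of k] by (intro divide_right_mono) auto
      then show "ln (T k) / ln (N k) \<le> \<beta> + ln 32 / ln (N k)" using u[of k] by (simp add: add_divide_distrib)
    qed
    have "(\<lambda>k. ln 32 / ln (N k)) \<longlonglongrightarrow> 0"
      by (rule tendsto_divide_0[OF tendsto_const filterlim_at_top_imp_at_infinity[OF ln_N_at_top]])
    from tendsto_add[OF tendsto_const[of \<beta>] this] show "(\<lambda>k. \<beta> + ln 32 / ln (N k)) \<longlonglongrightarrow> \<beta>" by simp
  qed
  have ratio: "ln (N k powr L / 2 ^ (k + 7)) / ln (T k) =
      (ln (N k powr L / 2 ^ (k + 7)) / ln (N k)) / (ln (T k) / ln (N k))" for k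
    using u[of k] by simp
  have "\<beta> \<noteq> 0" using \<beta> by simp
  from tendsto_divide[OF num den this] show ?thesis unfolding ratio \<beta>_def .
qed

lemma freq_at_top: "filterlim T at_top sequentially"
proof (rule filterlim_at_top_mono)
  have "filterlim (\<lambda>k. (1 / 2 - \<theta>) * ln (N k)) at_top sequentially"
    by (rule filterlim_tendsto_pos_mult_at_top[OF tendsto_const _ ln_N_at_top]) (use \<theta> in auto)
  from filterlim_compose[OF exp_at_top this]
  show "filterlim (\<lambda>k. exp ((1 / 2 - \<theta>) * ln (N k))) at_top sequentially" .
  show "\<forall>\<^sub>F k in sequentially. exp ((1 / 2 - \<theta>) * ln (N k)) \<le> T k"
  proof (intro always_eventually allI)
    fix k
    have "scale_at k \<noteq> 0" using scale_ge_2[of k] by simp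
    then show "exp ((1 / 2 - \<theta>) * ln (N k)) \<le> T k" using freq_ge[of k] by (simp add: powr_def)
  qed
qed

lemma order_lower:
  assumes \<sigma>: "\<theta> < \<sigma>" "\<sigma> < 1 / 2"
  shows "ereal ((1 / 2 - \<sigma>) / (1 / 2 - \<theta>)) \<le> lindelof_order a \<sigma>"
proof (rule lindelof_order_ge[OF freq_at_top _ ln_ratio_tendsto])
  show "\<forall>\<^sub>F k in sequentially. 0 < N k powr (1 / 2 - \<sigma>) / 2 ^ (k + 7) \<and>
      N k powr (1 / 2 - \<sigma>) / 2 ^ (k + 7) \<le> cmod (dirichlet_sum a (Complex \<sigma> (T k)))"
    using resonance[OF \<sigma>]
  proof eventually_elim
    case (elim k)
    then show ?case using N_ge_2[of k] by simp
  qed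
qed

lemma order_upper:
  assumes \<sigma>: "\<theta> < \<sigma>" "\<sigma> < 1 / 2"
  shows "lindelof_order a \<sigma> \<le> ereal ((1 / 2 - \<sigma>) / (1 / 2 - \<theta>))"
proof -
  have "\<exists>M. \<forall>t. \<bar>t\<bar> \<ge> 1 \<longrightarrow> cmod (dirichlet_sum a (Complex \<sigma> t))
              \<le> M * \<bar>t\<bar> powr ((1 / 2 - \<sigma>) / (1 / 2 - (Re 0 + \<theta>)))"
    by (rule dirichlet_growth[OF norm_coeff_le, where s\<^sub>0 = 0 and \<kappa> = \<theta> and D = 4 and \<sigma> = \<sigma>])
       (use norm_psum_le \<sigma> \<theta> in \<open>auto simp: sum_coeff\<close>)
  then show ?thesis by (auto intro: lindelof_order_le)
qed

lemma order_half: "lindelof_order a (1 / 2) = 0"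
proof (rule antisym)
  have "lindelof_order a (1 / 2) \<le> ereal 0"
    by (rule lindelof_order_le[where M = 3]) (use dirichlet_sum_half in auto)
  then show "lindelof_order a (1 / 2) \<le> 0" by (simp add: zero_ereal_def)
  have "ereal 0 \<le> lindelof_order a (1 / 2)"
  proof (rule lindelof_order_ge[OF filterlim_real_sequentially, where r = "\<lambda>_. 1 / 25"])
    show "(\<lambda>k. ln (1 / 25) / ln (real k)) \<longlonglongrightarrow> 0"
      by (rule tendsto_divide_0[OF tendsto_const filterlim_at_top_imp_at_infinity])
         (rule filterlim_compose[OF ln_at_top filterlim_real_sequentially])
  qed (use dirichlet_sum_half in auto)
  then show "0 \<le> lindelof_order a (1 / 2)" by (simp add: zero_ereal_def)
qed

text \<open>
  If the series converged at \<open>s\<close> with \<open>Re s < \<theta>\<close>, its partial sums there would be bounded, and the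
  growth bound would give an order of at most \<open>(1/2-\<sigma>)/(1/2 - Re s)\<close>, less than the actual
  order \<open>(1/2-\<sigma>)/(1/2-\<theta>)\<close>.
\<close>

lemma conv_abscissa_coeff: "conv_abscissa a = ereal \<theta>"
proof (rule antisym)
  show "conv_abscissa a \<le> ereal \<theta>"
  proof (rule ereal_le_epsilon2)
    fix e :: real assume "0 < e"
      have "summable (\<lambda>n. dirichlet_term a (of_real (\<theta> + e)) (Suc n))"
        by (rule dirichlet_tail(1)[where s\<^sub>0 = 0 and C = 4 and \<kappa> = \<theta> and \<rho> = "\<theta> + e"])
           (use norm_psum_le \<theta> \<open>0 < e\<close> in \<open>auto simp: sum_coeff\<close>)
      then show "conv_abscissa a \<le> ereal \<theta> + ereal e"
        unfolding conv_abscissa_def by (intro INF_lower2[of "of_real (\<theta> + e)"]) auto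
  qed
  show "ereal \<theta> \<le> conv_abscissa a"
    unfolding conv_abscissa_def
  proof (rule INF_greatest)
    fix s assume "s \<in> {s. summable (\<lambda>n. dirichlet_term a s (Suc n))}"
    then have "Bseq (\<lambda>n. \<Sum>m<n. dirichlet_term a s (Suc m))"
      by (auto intro!: convergent_imp_Bseq simp: summable_iff_convergent)
    then obtain D where D: "\<And>n. cmod (\<Sum>m<n. dirichlet_term a s (Suc m)) \<le> D" unfolding Bseq_def by blast
    show "ereal \<theta> \<le> ereal (Re s)"
    proof (rule ccontr)
      assume "\<not> ereal \<theta> \<le> ereal (Re s)"
      then have s: "Re s < \<theta>" by simp
      define \<sigma> where "\<sigma> = (\<theta> + 1 / 2) / 2"
      have \<sigma>: "\<theta> < \<sigma>" "\<sigma> < 1 / 2" using \<theta> by (auto simp: \<sigma>_def)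
      have "\<exists>M. \<forall>t. \<bar>t\<bar> \<ge> 1 \<longrightarrow> cmod (dirichlet_sum a (Complex \<sigma> t))
              \<le> M * \<bar>t\<bar> powr ((1 / 2 - \<sigma>) / (1 / 2 - (Re s + 0)))"
        by (rule dirichlet_growth[OF norm_coeff_le, where s\<^sub>0 = s and \<kappa> = 0 and D = D and \<sigma> = \<sigma>])
           (use D s \<sigma> \<theta> in auto)
      then have "lindelof_order a \<sigma> \<le> ereal ((1 / 2 - \<sigma>) / (1 / 2 - Re s))"
        by (auto intro: lindelof_order_le)
      with order_lower[OF \<sigma>] have "ereal ((1 / 2 - \<sigma>) / (1 / 2 - \<theta>)) \<le> ereal ((1 / 2 - \<sigma>) / (1 / 2 - Re s))"
        by (rule order_trans)
      moreover have "(1 / 2 - \<sigma>) / (1 / 2 - Re s) < (1 / 2 - \<sigma>) / (1 / 2 - \<theta>)"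
        using s \<sigma> \<theta> by (intro divide_strict_left_mono) auto
      ultimately show False by simp
    qed
  qed
qed

text \<open>
  Absolute convergence at \<open>s\<close> with \<open>Re s < 1/2\<close> would bound the series on every vertical line to the
  right of \<open>s\<close>, but between \<open>max \<theta> (Re s)\<close> and \<open>1/2\<close> its order is positive.
\<close>

lemma abs_conv_abscissa_coeff: "abs_conv_abscissa a = ereal (1 / 2)"
proof (rule antisym)
  show "abs_conv_abscissa a \<le> ereal (1 / 2)"
    unfolding abs_conv_abscissa_def
    by (intro INF_lower2[of "of_real (1 / 2)"]) (use abs_summable_half[of "of_real (1 / 2)"] in auto)
  show "ereal (1 / 2) \<le> abs_conv_abscissa a"
    unfolding abs_conv_abscissa_def
  proof (rule INF_greatest)
    fix s assume "s \<in> {s. summable (\<lambda>n. cmod (dirichlet_term a s (Suc n)))}"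
    then have sum: "summable (\<lambda>n. cmod (dirichlet_term a s (Suc n)))" by simp
    show "ereal (1 / 2) \<le> ereal (Re s)"
    proof (rule ccontr)
      assume "\<not> ereal (1 / 2) \<le> ereal (Re s)"
      then have s: "Re s < 1 / 2" by simp
      define \<sigma> where "\<sigma> = (max \<theta> (Re s) + 1 / 2) / 2"
      have \<sigma>: "\<theta> < \<sigma>" "\<sigma> < 1 / 2" "Re s \<le> \<sigma>" using \<theta> s by (auto simp: \<sigma>_def max_def)
      have "cmod (dirichlet_sum a (Complex \<sigma> t)) \<le> (\<Sum>n. cmod (dirichlet_term a s (Suc n)))" for t
        unfolding dirichlet_sum_def
      proof (rule norm_suminf_le[OF _ sum])
        fix n
        show "cmod (dirichlet_term a (Complex \<sigma> t) (Suc n)) \<le> cmod (dirichlet_term a s (Suc n))"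
          using \<sigma> by (simp add: norm_dirichlet_term mult_left_mono powr_mono del: of_nat_Suc)
      qed
      then have "lindelof_order a \<sigma> \<le> ereal 0"
        by (intro lindelof_order_le[where M = "\<Sum>n. cmod (dirichlet_term a s (Suc n))"]) auto
      with order_lower[OF \<sigma>(1,2)] have "ereal ((1 / 2 - \<sigma>) / (1 / 2 - \<theta>)) \<le> ereal 0"
        by (rule order_trans)
      moreover have "0 < (1 / 2 - \<sigma>) / (1 / 2 - \<theta>)" using \<sigma> \<theta> by simp
      ultimately show False by simp
    qed
  qed
qed

end

theorem theorem6:
  fixes \<theta> :: real
  assumes "- 1 / 2 < \<theta>" and "\<theta> < 1 / 2"
  shows "\<exists>g :: nat \<Rightarrow> complex.
           g \<in> hardy_H2 \<and>
           conv_abscissa g = ereal \<theta> \<and>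
           abs_conv_abscissa g = ereal (1 / 2) \<and>
           (\<forall>\<sigma>::real. \<theta> < \<sigma> \<and> \<sigma> \<le> 1 / 2 \<longrightarrow>
              lindelof_order g \<sigma> = ereal ((1 - 2 * \<sigma>) / (1 - 2 * \<theta>)))"
proof -
  interpret lacunary_series \<theta> using assms by unfold_locales
  have "lindelof_order (coeff \<theta>) \<sigma> = ereal ((1 - 2 * \<sigma>) / (1 - 2 * \<theta>))"
    if \<sigma>: "\<theta> < \<sigma> \<and> \<sigma> \<le> 1 / 2" for \<sigma>
  proof (cases "\<sigma> = 1 / 2")
    case True
    show ?thesis unfolding True order_half by (simp add: zero_ereal_def)
  next
    case False
    have "(1 / 2 - \<sigma>) / (1 / 2 - \<theta>) = (2 * (1 / 2 - \<sigma>)) / (2 * (1 / 2 - \<theta>))"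
      by (rule mult_divide_mult_cancel_left[symmetric]) simp
    also have "\<dots> = (1 - 2 * \<sigma>) / (1 - 2 * \<theta>)" by (simp add: right_diff_distrib)
    finally have eq: "(1 / 2 - \<sigma>) / (1 / 2 - \<theta>) = (1 - 2 * \<sigma>) / (1 - 2 * \<theta>)" .
    show ?thesis
      using order_lower[of \<sigma>] order_upper[of \<sigma>] False \<sigma> unfolding eq by (intro antisym) auto
  qed
  then show ?thesis
    using coeff_in_H2 conv_abscissa_coeff abs_conv_abscissa_coeff by blast
qed

end
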